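(* Let $r>0$. If $$\lim_{s\to 0}\frac{\mu(B(0,\eta s))}{\mu(B(0,s))}=0\quad\text{for every }\eta\in\,]0,1[,$$ then $$D_{\mu,r}^{\infty}(R)\sim (b_\mu^{-1}(R))^{r}e^{-R}\quad\text{as }R\to\infty.$$
   Context: Standing assumptions: $(E,\|\cdot\|)$ is a real separable Banach space of infinite dimension; $\mu$ is a non-atomic centered Gaussian Borel probability measure on $E$ whose support is all of $E$ (so all moments $\int\|x\|^r d\mu(x)$ are finite). For $a\in E$, $s>0$, $B(a,s)=\{x\in E:\|x-a\|\le s\}$ is the closed ball. The small ball function is $b_\mu(s)=-\log\mu(B(0,s))$, $s>0$ (natural logarithm); it is a continuous, strictly decreasing bijection of $]0,\infty[$ onto $]0,\infty[$, with inverse $b_\mu^{-1}$. A quantizer is a Borel-measurable map $f:E\to E$ whose image $f(E)$ is countable (finite or countably infinite); $\mathcal F$ is the set of all quantizers. $H_\mu^\infty(f) = -\log\big(\max\{\mu(f^{-1}(z)) : z\in f(E)\}\big)$ is the R\'enyi-$\infty$-entropy of $f$, and $D_{\mu,r}(f)=\int_E\|x-f(x)\|^r\,d\mu(x)$. For $R\ge0$, $$D_{\mu,r}^{\infty}(R)=\inf\{D_{\mu,r}(f): f\in\mathcal F,\ H_\mu^\infty(f)\le R\}.$$ Notation: $f\sim g$ as $x\to x_*$ means $\lim_{x\to x_*}f(x)/g(x)=1$. *)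

theory Defs
  imports "HOL-Probability.Probability" "HOL-Library.Landau_Symbols"
begin

text \<open>A separable Banach space is a type of sort \<open>{banach, second_countable_topology}\<close>:
  for metric spaces, separability and second countability coincide.\<close>

text \<open>Every continuous linear functional is a centered real Gaussian variable;
  the degenerate case \<open>\<sigma> = 0\<close> (the point mass at \<open>0\<close>) is allowed.\<close>

definition centered_gaussian_measure ::
    "'a::{banach, second_countable_topology} measure \<Rightarrow> bool" where
  "centered_gaussian_measure M \<longleftrightarrow>
     prob_space M \<and> sets M = sets borel \<and>
     (\<forall>\<phi> :: 'a \<Rightarrow> real. bounded_linear \<phi> \<longrightarrow>
        (\<exists>\<sigma>\<ge>0. distr M borel \<phi> =
           (if \<sigma> = 0 then return borel 0 else density lborel (normal_density 0 \<sigma>))))"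

definition atom_of :: "'a measure \<Rightarrow> 'a set \<Rightarrow> bool" where
  "atom_of M A \<longleftrightarrow> A \<in> sets M \<and> emeasure M A > 0 \<and>
     (\<forall>B\<in>sets M. B \<subseteq> A \<longrightarrow> emeasure M B = 0 \<or> emeasure M B = emeasure M A)"

definition nonatomic :: "'a measure \<Rightarrow> bool" where
  "nonatomic M \<longleftrightarrow> (\<nexists>A. atom_of M A)"

definition measure_support :: "'a::topological_space measure \<Rightarrow> 'a set" where
  "measure_support M = {x. \<forall>U. open U \<longrightarrow> x \<in> U \<longrightarrow> emeasure M U > 0}"

definition small_ball :: "'a::real_normed_vector measure \<Rightarrow> real \<Rightarrow> real" where
  "small_ball M s = - ln (measure M (cball 0 s))"

text \<open>Meaningful for \<open>M\<close> such that \<open>small_ball M\<close> is a bijection of \<open>{0<..}\<close> onto itself.\<close>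

definition small_ball_inv :: "'a::real_normed_vector measure \<Rightarrow> real \<Rightarrow> real" where
  "small_ball_inv M = the_inv_into {0<..} (small_ball M)"

definition quantizers :: "('a::topological_space \<Rightarrow> 'a) set" where
  "quantizers = {f \<in> borel_measurable borel. countable (range f)}"

text \<open>The supremum below is attained, see \<open>quantizer_max_attained\<close>; \<open>Max\<close> is
  unsuitable since the set of cell probabilities may be infinite.\<close>

definition renyi_infty_entropy :: "'a measure \<Rightarrow> ('a \<Rightarrow> 'a) \<Rightarrow> real" where
  "renyi_infty_entropy M f = - ln (SUP z\<in>range f. measure M (f -` {z}))"

text \<open>The distortion of a quantizer may be infinite, so it is a nonnegative Lebesgue integral
  (the Bochner integral of a non-integrable function would be \<open>0\<close>).\<close>

definition distortion :: "'a::real_normed_vector measure \<Rightarrow> real \<Rightarrow> ('a \<Rightarrow> 'a) \<Rightarrow> ennreal" where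
  "distortion M r f = (\<integral>\<^sup>+ x. ennreal (norm (x - f x) powr r) \<partial>M)"

text \<open>For \<open>R \<ge> 0\<close> the constant \<open>0\<close> is admissible in the infimum, which is therefore finite whenever
  \<open>M\<close> has a finite \<open>r\<close>-th moment; \<open>enn2real\<close> then loses no information.\<close>

definition optimal_distortion :: "'a::real_normed_vector measure \<Rightarrow> real \<Rightarrow> real \<Rightarrow> ennreal" where
  "optimal_distortion M r R =
     (INF f\<in>{f \<in> quantizers. renyi_infty_entropy M f \<le> R}. distortion M r f)"

lemma quantizer_max_attained:
  fixes M :: "'a::{banach, second_countable_topology} measure"
  assumes M: "prob_space M" "sets M = sets borel" and f: "f \<in> quantizers"
  shows "\<exists>z\<in>range f. measure M (f -` {z}) = (SUP z\<in>range f. measure M (f -` {z}))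
           \<and> measure M (f -` {z}) > 0"
proof -
  interpret prob_space M by fact
  let ?p = "\<lambda>z. measure M (f -` {z})"
  have sp: "space M = UNIV" using sets_eq_imp_space_eq[OF M(2)] by simp
  have fm: "f \<in> borel_measurable borel" and c: "countable (range f)"
    using f by (auto simp: quantizers_def)
  have ms: "f -` S \<in> sets M" if "S \<in> sets borel" for S
    using measurable_sets[OF fm that] M(2) by simp
  have ms1: "f -` {z} \<in> sets M" for z by (rule ms) simp
  have pos: "\<exists>z\<in>range f. ?p z > 0"
  proof (rule ccontr)
    assume "\<not> ?thesis"
    then have "?p z = 0" if "z \<in> range f" for z
      using that by (auto simp: zero_less_measure_iff)
    then have "\<forall>z\<in>range f. f -` {z} \<in> null_sets M"
      using ms1 by (auto simp: null_sets_def emeasure_eq_measure)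
    then have "(\<Union>z\<in>range f. f -` {z}) \<in> null_sets M"
      by (intro null_sets_UN'[OF c]) (rule bspec)
    moreover have "(\<Union>z\<in>range f. f -` {z}) = space M" using sp by auto
    ultimately show False using emeasure_space_1 by (auto simp: null_sets_def)
  qed
  then obtain z0 where z0: "z0 \<in> range f" "?p z0 > 0" by blast
  define F where "F = {z\<in>range f. ?p z \<ge> ?p z0}"
  have cardle: "real (card G) * ?p z0 \<le> 1" if G: "finite G" "G \<subseteq> F" for G
  proof -
    have "real (card G) * ?p z0 = (\<Sum>z\<in>G. ?p z0)" by simp
    also have "\<dots> \<le> (\<Sum>z\<in>G. ?p z)" using G by (intro sum_mono) (auto simp: F_def)
    also have "\<dots> = measure M (\<Union>z\<in>G. f -` {z})"
      using G ms1 by (intro finite_measure_finite_Union[symmetric]) (auto simp: disjoint_family_on_def)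
    also have "\<dots> \<le> 1" by (rule prob_le_1)
    finally show ?thesis .
  qed
  have finF: "finite F"
  proof (rule ccontr)
    assume inf: "infinite F"
    obtain n :: nat where n: "1 / ?p z0 < real n" using reals_Archimedean2 by blast
    obtain G where "finite G" "G \<subseteq> F" "card G = n"
      using infinite_arbitrarily_large[OF inf] by blast
    with cardle have "real n * ?p z0 \<le> 1" by blast
    with n z0 show False by (simp add: field_simps)
  qed
  have z0F: "z0 \<in> F" using z0 by (simp add: F_def)
  have "Max (?p ` F) \<in> ?p ` F" using finF z0F by (intro Max_in) blast+
  then obtain z where zM: "Max (?p ` F) = ?p z" and zF: "z \<in> F" by (rule imageE)
  have z: "z \<in> F" "\<And>w. w \<in> F \<Longrightarrow> ?p w \<le> ?p z"
    using zF Max_ge[OF finite_imageI[OF finF, of ?p]] unfolding zM by blast+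
  have zr: "z \<in> range f" "?p z \<ge> ?p z0" using z by (auto simp: F_def)
  have "?p w \<le> ?p z" if "w \<in> range f" for w
    using z(2)[of w] zr(2) that by (cases "w \<in> F") (auto simp: F_def)
  then have "(SUP z\<in>range f. ?p z) = ?p z"
    using zr(1) by (intro cSup_eq_maximum) blast+
  moreover have "?p z > 0" using zr(2) z0(2) by linarith
  ultimately show ?thesis using zr(1) by metis
qed

end

(*
The constraint H(f) <= R says that some cell of f has mass at least exp(-R); all other cells
may be chosen arbitrarily fine and contribute nothing. Let s be the radius with
mu(B(0,s)) = exp(-R). Using B(0,s) as the distinguished cell, with representative 0, gives
D(R) <= s^r exp(-R). Conversely, if A is a cell with representative z and mu(A) >= exp(-R), then
for eta < 1 the part of A outside B(z, eta s) has distortion at least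
(eta s)^r (exp(-R) - mu(B(z, eta s))), and by Anderson's inequality
mu(B(z, eta s)) <= mu(B(0, eta s)), which is o(exp(-R)) by hypothesis. Now let eta tend to 1.

Anderson's inequality, and the continuity of s |-> mu(B(0,s)), both follow from the
midpoint log-concavity mu(B(a,s)) mu(B(b,t)) <= mu(B((a+b)/2,(s+t)/2))^2. Norming functionals
reduce it to finitely many Gaussian variables, a Gram-Schmidt process makes these independent,
and for independent Gaussians it is the Prekopa-Leindler inequality at the midpoint, which
tensorizes from dimension one.
*)
theory Submission
  imports Defs
begin

section \<open>Norming functionals\<close>

text \<open>The midpoint inequality allows different centres and different radii, so that it does
  both jobs: centres \<open>a\<close> and \<open>- a\<close> with equal radii give Anderson's
  inequality, equal centres with different radii exclude jumps of the mass as a function of the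
  radius. If the mass jumped, there might be no radius of mass exactly \<open>exp (- R)\<close>, and
  the upper bound would contain the larger mass after the jump. The definition of a Gaussian measure
  speaks of one functional at a time, so joint laws have to be recovered. Linear combinations of
  functionals are functionals, hence their characteristic functions are known; coordinates are split
  off one by one, which keeps the uniqueness theorem for characteristic functions one-dimensional.
  Log-concavity is carried as an inequality between integrals of functions, because integrating out
  one coordinate turns an indicator into a general function.\<close>

definition sublinear :: "('a::real_vector \<Rightarrow> real) \<Rightarrow> bool" where
  "sublinear p \<longleftrightarrow> (\<forall>x y. p (x + y) \<le> p x + p y) \<and> (\<forall>c>0. \<forall>x. p (c *\<^sub>R x) = c * p x)"

text \<open>The reverse scaling inequality is the assumed one with factor \<open>inverse c\<close>
  at the point \<open>c *\<^sub>R x\<close>.\<close>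

lemma sublinearI:
  assumes "\<And>x y. p (x + y) \<le> p x + p y" and "\<And>c x. c > 0 \<Longrightarrow> p (c *\<^sub>R x) \<le> c * p x"
  shows "sublinear p"
proof -
  have "c * p x \<le> p (c *\<^sub>R x)" if "c > 0" for c x
    using assms(2)[of "inverse c" "c *\<^sub>R x"] that by (simp add: field_simps)
  with assms show ?thesis unfolding sublinear_def by (auto intro: antisym)
qed

lemma sublinear_add: "sublinear p \<Longrightarrow> p (x + y) \<le> p x + p y"
  and sublinear_scale: "sublinear p \<Longrightarrow> c > 0 \<Longrightarrow> p (c *\<^sub>R x) = c * p x"
  by (auto simp: sublinear_def)

lemma sublinear_zero: "sublinear p \<Longrightarrow> p 0 = 0"
  using sublinear_scale[of p 2 0] by simp

lemma sublinear_neg: "sublinear p \<Longrightarrow> - p (- x) \<le> p x"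
  using sublinear_add[of p x "- x"] sublinear_zero[of p] by simp

text \<open>Replacing \<open>p\<close> by \<open>directional_inf p y\<close> keeps it sublinear and does not increase it, so for a minimal
  \<open>p\<close> the two agree; taking \<open>t = 1\<close> then gives superadditivity. Hence minimal sublinear
  functionals are linear, which yields the Hahn-Banach theorem.\<close>

definition directional_inf :: "('a::real_vector \<Rightarrow> real) \<Rightarrow> 'a \<Rightarrow> 'a \<Rightarrow> real" where
  "directional_inf p y x = (INF t\<in>{0..}. p (x + t *\<^sub>R y) - t * p y)"

text \<open>The lower bound does not depend on \<open>t\<close>, so the infimum in
  \<open>directional_inf\<close> is a genuine one.\<close>

lemma directional_inf_lower:
  assumes "sublinear p" "t \<ge> 0"
  shows "- p (- x) \<le> p (x + t *\<^sub>R y) - t * p y"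
proof -
  have "p (t *\<^sub>R y) \<le> p (x + t *\<^sub>R y) + p (- x)"
    using sublinear_add[OF assms(1), of "x + t *\<^sub>R y" "- x"] by simp
  moreover have "p (t *\<^sub>R y) = t * p y"
    using assms sublinear_zero[OF assms(1)] sublinear_scale[OF assms(1)] by (cases "t = 0") auto
  ultimately show ?thesis by simp
qed

lemma directional_inf_le:
  assumes "sublinear p" "t \<ge> 0"
  shows "directional_inf p y x \<le> p (x + t *\<^sub>R y) - t * p y"
  unfolding directional_inf_def
proof (rule cINF_lower)
  show "bdd_below ((\<lambda>t. p (x + t *\<^sub>R y) - t * p y) ` {0..})"
    using directional_inf_lower[OF assms(1)] by (intro bdd_belowI2[of _ "- p (- x)"]) auto
qed (use assms in auto)

lemma directional_inf_greatest:
  assumes "\<And>t. t \<ge> 0 \<Longrightarrow> m \<le> p (x + t *\<^sub>R y) - t * p y"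
  shows "m \<le> directional_inf p y x"
  unfolding directional_inf_def using assms by (intro cINF_greatest) auto

text \<open>The half-line of parameters is closed under addition and positive scaling:
  \<open>t\<close> for \<open>u\<close> and \<open>t'\<close> for \<open>v\<close> combine to
  \<open>t + t'\<close> for \<open>u + v\<close>, and \<open>t\<close> for \<open>x\<close> becomes
  \<open>c * t\<close> for \<open>c *\<^sub>R x\<close>.\<close>

lemma sublinear_directional_inf:
  assumes p: "sublinear p"
  shows "sublinear (directional_inf p y)"
proof (rule sublinearI)
  fix u v
  have "directional_inf p y (u + v) - (p (v + t' *\<^sub>R y) - t' * p y) \<le> p (u + t *\<^sub>R y) - t * p y"
    if "t \<ge> 0" "t' \<ge> 0" for t t'
  proof -
    have "directional_inf p y (u + v) \<le> p (u + v + (t + t') *\<^sub>R y) - (t + t') * p y"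
      using that by (intro directional_inf_le p) auto
    also have "p (u + v + (t + t') *\<^sub>R y) \<le> p (u + t *\<^sub>R y) + p (v + t' *\<^sub>R y)"
      using sublinear_add[OF p, of "u + t *\<^sub>R y" "v + t' *\<^sub>R y"] by (simp add: algebra_simps)
    finally show ?thesis by (simp add: algebra_simps)
  qed
  then have "directional_inf p y (u + v) - (p (v + t' *\<^sub>R y) - t' * p y) \<le> directional_inf p y u"
    if "t' \<ge> 0" for t' using that by (intro directional_inf_greatest) auto
  then have "directional_inf p y (u + v) - directional_inf p y u \<le> p (v + t' *\<^sub>R y) - t' * p y"
    if "t' \<ge> 0" for t' using that by (fastforce simp: algebra_simps)
  then have "directional_inf p y (u + v) - directional_inf p y u \<le> directional_inf p y v"
    by (intro directional_inf_greatest)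
  then show "directional_inf p y (u + v) \<le> directional_inf p y u + directional_inf p y v" by simp
next
  fix c :: real and x assume c: "c > 0"
  have "directional_inf p y (c *\<^sub>R x) / c \<le> directional_inf p y x"
  proof (rule directional_inf_greatest)
    fix t :: real assume t: "t \<ge> 0"
    have "directional_inf p y (c *\<^sub>R x) \<le> p (c *\<^sub>R x + (c * t) *\<^sub>R y) - (c * t) * p y"
      using c t by (intro directional_inf_le p) auto
    also have "\<dots> = c * (p (x + t *\<^sub>R y) - t * p y)"
      using sublinear_scale[OF p c, of "x + t *\<^sub>R y"] by (simp add: algebra_simps)
    finally show "directional_inf p y (c *\<^sub>R x) / c \<le> p (x + t *\<^sub>R y) - t * p y"
      using c by (simp add: field_simps)
  qed
  then show "directional_inf p y (c *\<^sub>R x) \<le> c * directional_inf p y x"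
    using c by (simp add: field_simps)
qed

lemma exists_minimal_sublinear:
  fixes q :: "'a::real_vector \<Rightarrow> real"
  assumes q: "sublinear q"
  obtains p where "sublinear p" "p \<le> q" "\<And>p'. sublinear p' \<Longrightarrow> p' \<le> p \<Longrightarrow> p' = p"
proof -
  define A where "A = {p. sublinear p \<and> p \<le> q}"
  \<comment> \<open>The order is reversed, so the upper bound that Zorn's lemma asks of a chain is
    its pointwise infimum. It is finite because every member lies above \<open>- q (- x)\<close> at
    \<open>x\<close>.\<close>
  let ?P = "\<lambda>p p' :: 'a \<Rightarrow> real. p' \<le> p"
  have "\<exists>m\<in>A. \<forall>a\<in>A. ?P m a \<longrightarrow> a = m"
  proof (rule predicate_Zorn)
    show "partial_order_on A (relation_of ?P A)"
      by (rule partial_order_on_relation_ofI) auto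
  next
    fix C assume C: "C \<in> Chains (relation_of ?P A)"
    then have CA: "C \<subseteq> A" and tot: "\<And>p p'. p \<in> C \<Longrightarrow> p' \<in> C \<Longrightarrow> p \<le> p' \<or> p' \<le> p"
      by (auto simp: Chains_def relation_of_def)
    show "\<exists>u\<in>A. \<forall>a\<in>C. ?P a u"
    proof (cases "C = {}")
      case True
      with q show ?thesis by (auto simp: A_def)
    next
      case False
      define u where "u x = (INF p\<in>C. p x)" for x
      have bdd: "bdd_below ((\<lambda>p. p x) ` C)" for x
      proof (rule bdd_belowI2)
        fix p assume "p \<in> C"
        then have "sublinear p" "p (- x) \<le> q (- x)" using CA by (auto simp: A_def le_fun_def)
        then show "- q (- x) \<le> p x" using sublinear_neg[of p x] by linarith
      qed
      have low: "u x \<le> p x" if "p \<in> C" for p x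
        unfolding u_def using bdd that by (rule cINF_lower)
      have gr: "m \<le> u x" if "\<And>p. p \<in> C \<Longrightarrow> m \<le> p x" for m x
        unfolding u_def using False that by (rule cINF_greatest)
      have "sublinear u"
      proof (rule sublinearI)
        fix x y
        \<comment> \<open>Two members of the chain are comparable, and the smaller one bounds both
          terms at once; an infimum over an arbitrary family would not allow this.\<close>
        have "u (x + y) - p' y \<le> p x" if p: "p \<in> C" "p' \<in> C" for p p'
        proof -
          obtain p'' where p'': "p'' \<in> C" "p'' \<le> p" "p'' \<le> p'" using tot[OF p] p by auto
          have "u (x + y) \<le> p'' (x + y)" using low p'' by auto
          also have "\<dots> \<le> p'' x + p'' y" using p'' CA by (auto intro!: sublinear_add simp: A_def)
          also have "\<dots> \<le> p x + p' y" using p'' by (auto intro!: add_mono simp: le_fun_def)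
          finally show ?thesis by simp
        qed
        then have "u (x + y) - p' y \<le> u x" if "p' \<in> C" for p' using that by (intro gr)
        then have "u (x + y) - u x \<le> p' y" if "p' \<in> C" for p' using that by (fastforce simp: algebra_simps)
        then have "u (x + y) - u x \<le> u y" by (intro gr)
        then show "u (x + y) \<le> u x + u y" by simp
      next
        fix c :: real and x assume c: "c > 0"
        have "u (c *\<^sub>R x) / c \<le> u x"
        proof (rule gr)
          fix p assume p: "p \<in> C"
          have "u (c *\<^sub>R x) \<le> c * p x"
            using low[OF p, of "c *\<^sub>R x"] sublinear_scale[of p c x] CA p c by (auto simp: A_def)
          then show "u (c *\<^sub>R x) / c \<le> p x" using c by (simp add: field_simps)
        qed
        then show "u (c *\<^sub>R x) \<le> c * u x" using c by (simp add: field_simps)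
      qed
      moreover have "u \<le> q"
      proof -
        obtain p where "p \<in> C" using False by auto
        with low[OF this] CA show ?thesis by (auto simp: le_fun_def A_def intro: order_trans)
      qed
      ultimately have "u \<in> A" by (simp add: A_def)
      with low show ?thesis by (auto simp: le_fun_def)
    qed
  qed
  then obtain p where p: "p \<in> A" "\<And>p'. p' \<in> A \<Longrightarrow> p' \<le> p \<Longrightarrow> p' = p" by blast
  show ?thesis
  proof (rule that)
    fix p' assume "sublinear p'" "p' \<le> p"
    with p show "p' = p" by (auto simp: A_def)
  qed (use p in \<open>auto simp: A_def\<close>)
qed

lemma linear_minimal_sublinear:
  assumes p: "sublinear p" and min: "\<And>p'. sublinear p' \<Longrightarrow> p' \<le> p \<Longrightarrow> p' = p"
  shows "linear p"
proof -
  have "directional_inf p y = p" for y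
  proof (rule min)
    show "directional_inf p y \<le> p"
      using directional_inf_le[OF p, of 0] by (auto simp: le_fun_def)
  qed (rule sublinear_directional_inf[OF p])
  then have "p x + p y \<le> p (x + y)" for x y
    using directional_inf_le[OF p, of 1 y x] by simp
  then have add: "p (x + y) = p x + p y" for x y using sublinear_add[OF p] by (auto intro: antisym)
  have neg: "p (- x) = - p x" for x using add[of x "- x"] sublinear_zero[OF p] by simp
  have "p (c *\<^sub>R x) = c * p x" for c x
  proof -
    consider "c = 0" | "c > 0" | "c < 0" by linarith
    then show ?thesis
    proof cases
      case 3
      then have "p ((- c) *\<^sub>R x) = - c * p x" by (intro sublinear_scale p) auto
      with neg[of "c *\<^sub>R x"] show ?thesis by simp
    qed (use p in \<open>auto simp: sublinear_zero sublinear_scale\<close>)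
  qed
  with add show ?thesis by (intro linearI) auto
qed

lemma exists_norming_functional:
  fixes z :: "'a::real_normed_vector"
  obtains f :: "'a \<Rightarrow> real"
  where "bounded_linear f" "\<And>x. \<bar>f x\<bar> \<le> norm x" "f z = norm z"
proof -
  have n: "sublinear (norm :: 'a \<Rightarrow> real)" by (intro sublinearI norm_triangle_ineq) auto
  \<comment> \<open>starting below \<open>directional_inf norm z\<close> forces \<open>p (- z) \<le> - norm z\<close>\<close>
  obtain p where p: "sublinear p" "p \<le> directional_inf norm z"
    and min: "\<And>p'. sublinear p' \<Longrightarrow> p' \<le> p \<Longrightarrow> p' = p"
    using exists_minimal_sublinear[OF sublinear_directional_inf[OF n]] by metis
  have lin: "linear p" using linear_minimal_sublinear[OF p(1) min] .
  have le: "p x \<le> norm x" for x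
    using p(2) directional_inf_le[OF n, of 0 z x] by (auto simp: le_fun_def intro: order_trans)
  have abs_le: "\<bar>p x\<bar> \<le> norm x" for x
    using le[of x] le[of "- x"] linear_neg[OF lin, of x] by (simp add: abs_le_iff)
  have "p (- z) \<le> - norm z"
    using p(2) directional_inf_le[OF n, of 1 z "- z"] by (auto simp: le_fun_def intro: order_trans)
  with le[of z] linear_neg[OF lin, of z] have "p z = norm z" by simp
  moreover have "bounded_linear p"
    using lin abs_le by (intro bounded_linear_intro[of _ 1]) (auto simp: linear_add linear_scale)
  ultimately show ?thesis using abs_le that by blast
qed

text \<open>Each point of a countable dense set gets its own norming functional. Countability later
  presents a closed ball as a decreasing limit of sets given by finitely many functionals.\<close>

lemma exists_norming_sequence:
  obtains \<phi> :: "nat \<Rightarrow> 'a::{real_normed_vector, second_countable_topology} \<Rightarrow> real"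
  where "\<And>n. bounded_linear (\<phi> n)" "\<And>x t. norm x \<le> t \<longleftrightarrow> (\<forall>n. \<bar>\<phi> n x\<bar> \<le> t)"
proof -
  obtain D :: "'a set" where D: "countable D" "\<And>X. open X \<Longrightarrow> X \<noteq> {} \<Longrightarrow> \<exists>d\<in>D. d \<in> X"
    using countable_dense_setE by metis
  have "D \<noteq> {}" using D(2)[of UNIV] by auto
  define d where "d = from_nat_into D"
  have "\<exists>f :: 'a \<Rightarrow> real. bounded_linear f \<and> (\<forall>x. \<bar>f x\<bar> \<le> norm x) \<and> f (d n) = norm (d n)" for n
    using exists_norming_functional[of "d n"] by metis
  then obtain \<phi> :: "nat \<Rightarrow> 'a \<Rightarrow> real"
    where \<phi>: "\<And>n. bounded_linear (\<phi> n)" "\<And>n x. \<bar>\<phi> n x\<bar> \<le> norm x" "\<And>n. \<phi> n (d n) = norm (d n)"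
    by metis
  have "norm x \<le> t" if t: "\<forall>n. \<bar>\<phi> n x\<bar> \<le> t" for x t
  proof (rule field_le_epsilon)
    fix e :: real assume "e > 0"
    then obtain y where "y \<in> D" "y \<in> ball x (e / 2)" using D(2)[of "ball x (e / 2)"] by auto
    then obtain n where n: "norm (x - d n) < e / 2"
      using from_nat_into_surj[OF D(1)] by (metis d_def dist_norm mem_ball)
    \<comment> \<open>The distance to \<open>d n\<close> is paid twice, here and when the functional
      is moved from \<open>d n\<close> to \<open>x\<close>; hence the \<open>e / 2\<close>.\<close>
    have "norm x \<le> norm (d n) + norm (x - d n)" by (metis add.commute diff_add_cancel norm_triangle_ineq)
    also have "norm (d n) = \<phi> n x - \<phi> n (x - d n)"
      using \<phi>(3)[of n] linear_diff[OF bounded_linear.linear[OF \<phi>(1)], of n x "d n"] by simp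
    also have "\<dots> \<le> t + norm (x - d n)"
      using t[rule_format, of n] \<phi>(2)[of n "x - d n"] by linarith
    finally show "norm x \<le> t + e" using n by simp
  qed
  then show ?thesis using \<phi> that[of \<phi>] order_trans by metis
qed

section \<open>Prekopa inequality at the midpoint\<close>

text \<open>Cutting at a point of \<open>A\<close> gives a set with a largest element, as
  Brunn-Minkowski wants it, without compact approximation. Countably many half-lines cover
  everything below some point of \<open>A\<close>, and what is left of \<open>A\<close> is at most
  its maximum, a null set.\<close>

lemma emeasure_lborel_atMost_SUP:
  assumes A: "A \<in> sets borel" "A \<noteq> {}"
  shows "emeasure lborel A \<le> (SUP a\<in>A. emeasure lborel (A \<inter> {..a :: real}))" (is "_ \<le> ?s")
proof -
  obtain F where F: "F \<subseteq> lessThan ` A" "countable F" "\<Union>F = \<Union>(lessThan ` A)"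
    by (rule Lindelof[of "lessThan ` A"]) (auto intro: that)
  show ?thesis
  proof (cases "F = {}")
    case True
    with F(3) A obtain a where "a \<in> A" by auto
    then have "a - 1 \<in> \<Union>F" unfolding F(3) by (auto intro!: bexI[of _ a])
    with True show ?thesis by simp
  next
    case False
    obtain A' where A': "countable A'" "A' \<subseteq> A" "F = lessThan ` A'"
      using countable_subset_image[of F lessThan A] F by auto
    with False have "A' \<noteq> {}" by auto
    define e where "e = from_nat_into A'"
    have eA: "e n \<in> A" for n using from_nat_into[OF \<open>A' \<noteq> {}\<close>] A' by (auto simp: e_def)
    \<comment> \<open>Running maxima turn the enumeration into an increasing sequence inside
      \<open>A\<close>, as continuity from below requires.\<close>
    define m where "m n = Max (e ` {..n})" for n
    have mA: "m n \<in> A" for n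
    proof -
      have "m n \<in> e ` {..n}" unfolding m_def by (rule Max_in) auto
      then show ?thesis using eA by auto
    qed
    have minc: "m i \<le> m j" if "i \<le> j" for i j
      unfolding m_def using that by (intro Max_mono) auto
    have em: "e n \<le> m n" for n unfolding m_def by (rule Max_ge) auto
    define U where "U = (\<Union>n. {..<m n})"
    have U: "x \<in> U" if "x \<in> A" "a \<in> A" "x < a" for x a
    proof -
      have "x \<in> \<Union>F" using F(3) that by auto
      then obtain a' where "a' \<in> A'" "x < a'" using A' by auto
      then obtain n where "x < e n"
        using from_nat_into_surj[OF A'(1), of a'] by (auto simp: e_def)
      with em[of n] show ?thesis by (auto simp: U_def intro!: exI[of _ n])
    qed
    \<comment> \<open>Of two points of \<open>A\<close> the smaller one lies in \<open>U\<close>, so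
      at most one point escapes.\<close>
    have "\<exists>z. A - U \<subseteq> {z}"
    proof (cases "A - U = {}")
      case False
      then obtain z where "z \<in> A - U" by auto
      then have "A - U \<subseteq> {z}" using U by (auto intro: antisym) (metis linorder_cases)
      then show ?thesis by auto
    qed auto
    then obtain z where z: "A - U \<subseteq> {z}" by auto
    have "emeasure lborel A \<le> emeasure lborel ((A \<inter> U) \<union> {z})"
      using A z by (intro emeasure_mono) (auto simp: U_def)
    also have "\<dots> \<le> emeasure lborel (A \<inter> U) + emeasure lborel {z}"
      using A by (intro emeasure_subadditive) (auto simp: U_def)
    also have "\<dots> = emeasure lborel (\<Union>n. A \<inter> {..<m n})" by (simp add: U_def)
    also have "\<dots> = (SUP n. emeasure lborel (A \<inter> {..<m n}))"
      using A minc by (intro SUP_emeasure_incseq[symmetric]) (auto simp: incseq_def intro: less_le_trans)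
    also have "\<dots> \<le> ?s"
    proof (rule SUP_least)
      fix n
      have "emeasure lborel (A \<inter> {..<m n}) \<le> emeasure lborel (A \<inter> {..m n})"
        using A by (intro emeasure_mono) auto
      also have "\<dots> \<le> ?s" using mA by (intro SUP_upper)
      finally show "emeasure lborel (A \<inter> {..<m n}) \<le> ?s" .
    qed
    finally show ?thesis .
  qed
qed

lemma emeasure_lborel_uminus:
  assumes "A \<in> sets borel"
  shows "emeasure lborel (uminus ` A) = emeasure lborel (A :: real set)"
proof -
  have "emeasure lborel A = emeasure (distr lborel borel uminus) A" by (simp add: lborel_distr_uminus)
  also have "\<dots> = emeasure lborel (uminus -` A)" using assms by (subst emeasure_distr) auto
  also have "uminus -` A = uminus ` A" by (force simp: image_iff)
  finally show ?thesis by simp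
qed

lemma sets_borel_uminus_image: "A \<in> sets borel \<Longrightarrow> uminus ` A \<in> sets (borel :: real measure)"
proof -
  assume "A \<in> sets borel"
  then have "uminus -` A \<inter> space borel \<in> sets (borel :: real measure)" by (intro measurable_sets) auto
  moreover have "uminus -` A = uminus ` A" by (force simp: image_iff)
  ultimately show ?thesis by simp
qed

lemma emeasure_lborel_atLeast_SUP:
  assumes A: "A \<in> sets borel" "A \<noteq> {}"
  shows "emeasure lborel A \<le> (SUP a\<in>A. emeasure lborel (A \<inter> {a :: real..}))"
proof -
  have "emeasure lborel A \<le> (SUP a\<in>uminus ` A. emeasure lborel (uminus ` A \<inter> {..a}))"
    using emeasure_lborel_atMost_SUP[of "uminus ` A"] A
    by (simp add: emeasure_lborel_uminus sets_borel_uminus_image)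
  also have "\<dots> = (SUP a\<in>A. emeasure lborel (A \<inter> {a..}))"
  proof -
    have "uminus ` A \<inter> {..- a} = uminus ` (A \<inter> {a..})" for a by (auto simp: image_iff)
    then show ?thesis using A by (simp add: image_image emeasure_lborel_uminus)
  qed
  finally show ?thesis .
qed

lemma emeasure_lborel_translate:
  assumes "A \<in> sets borel"
  shows "emeasure lborel {x. x - c \<in> A} = emeasure lborel (A :: real set)"
proof -
  have "emeasure lborel A = emeasure (distr lborel borel ((+) (- c))) A" by (simp add: lborel_distr_plus)
  also have "\<dots> = emeasure lborel ((+) (- c) -` A)" using assms by (subst emeasure_distr) auto
  also have "(+) (- c) -` A = {x. x - c \<in> A}" by auto
  finally show ?thesis by simp
qed

lemma emeasure_lborel_halve:
  assumes "S \<in> sets borel"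
  shows "emeasure lborel {x. x / 2 \<in> S} = 2 * emeasure lborel (S :: real set)"
proof -
  have "emeasure lborel S = emeasure (density (distr lborel borel ((*) (1/2))) (\<lambda>_. ennreal \<bar>1/2\<bar>)) S"
    using lborel_distr_mult'[of "1/2"] by simp
  also have "\<dots> = ennreal (1/2) * emeasure (distr lborel borel ((*) (1/2))) S"
    using assms by (simp add: emeasure_density nn_integral_cmult)
  also have "emeasure (distr lborel borel ((*) (1/2))) S = emeasure lborel {x. x / 2 \<in> S}"
    using assms by (subst emeasure_distr) (auto simp: vimage_def)
  finally have "2 * emeasure lborel S = (2 * ennreal (1/2)) * emeasure lborel {x. x / 2 \<in> S}"
    by (simp add: mult.assoc)
  also have "2 * ennreal (1/2) = 1"
    by (metis ennreal_1 ennreal_mult ennreal_numeral mult_numeral_1_right nonzero_eq_divide_eq numeral_One zero_le_divide_1_iff zero_le_numeral zero_neq_numeral mult.commute)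
  finally show ?thesis by simp
qed

text \<open>Cut \<open>A\<close> at \<open>a\<close> from above and \<open>B\<close> at
  \<open>b\<close> from below. The translates of the two pieces by \<open>b\<close> and by
  \<open>a\<close> meet at most in \<open>a + b\<close>, and both lie in twice \<open>S\<close>;
  their lengths therefore add up.\<close>

lemma brunn_minkowski_midpoint_real:
  fixes A B S :: "real set"
  assumes [measurable]: "A \<in> sets borel" "B \<in> sets borel" "S \<in> sets borel"
    and ne: "A \<noteq> {}" "B \<noteq> {}"
    and mid: "\<And>x y. x \<in> A \<Longrightarrow> y \<in> B \<Longrightarrow> (x + y) / 2 \<in> S"
  shows "emeasure lborel A + emeasure lborel B \<le> 2 * emeasure lborel S"
proof -
  have *: "emeasure lborel (A \<inter> {..a}) + emeasure lborel (B \<inter> {b..}) \<le> 2 * emeasure lborel S"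
    if "a \<in> A" "b \<in> B" for a b
  proof -
    let ?X = "{x. x - b \<in> A \<inter> {..a}}" and ?Y = "{x. x - a \<in> B \<inter> {b..}}"
    have "?X \<inter> ?Y \<subseteq> {a + b}" by auto
    then have "emeasure lborel (?X \<inter> ?Y) \<le> emeasure lborel {a + b}" by (rule emeasure_mono) simp
    then have null: "emeasure lborel (?X \<inter> ?Y) = 0" by simp
    have "emeasure lborel (A \<inter> {..a}) + emeasure lborel (B \<inter> {b..})
        = emeasure lborel ?X + emeasure lborel ?Y"
      using emeasure_lborel_translate[of "A \<inter> {..a}" b] emeasure_lborel_translate[of "B \<inter> {b..}" a]
      by simp
    also have "\<dots> = emeasure lborel (?X \<union> ?Y)"
      using emeasure_Un_Int[of ?X lborel ?Y] null by simp
    also have "\<dots> \<le> emeasure lborel {x. x / 2 \<in> S}"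
    proof (rule emeasure_mono)
      show "?X \<union> ?Y \<subseteq> {x. x / 2 \<in> S}"
        using mid[OF _ \<open>b \<in> B\<close>] mid[OF \<open>a \<in> A\<close>] by (fastforce simp: algebra_simps)
    qed simp
    also have "\<dots> = 2 * emeasure lborel S" by (rule emeasure_lborel_halve) simp
    finally show ?thesis .
  qed
  have "emeasure lborel A + emeasure lborel B
      \<le> (SUP a\<in>A. emeasure lborel (A \<inter> {..a})) + (SUP b\<in>B. emeasure lborel (B \<inter> {b..}))"
    using ne by (intro add_mono emeasure_lborel_atMost_SUP emeasure_lborel_atLeast_SUP) auto
  also have "\<dots> = (SUP b\<in>B. SUP a\<in>A. emeasure lborel (A \<inter> {..a}) + emeasure lborel (B \<inter> {b..}))"
    using ne by (simp only: ennreal_SUP_add_left[OF ne(1), symmetric] ennreal_SUP_add_right[OF ne(2)])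
  also have "\<dots> \<le> 2 * emeasure lborel S"
    using * by (intro SUP_least) auto
  finally show ?thesis .
qed

section \<open>Layer-cake formula and the Prekopa inequality on the line\<close>

lemma min_eq_layer_integral:
  assumes a: "0 < a"
  shows "min y (ennreal a)
    = ennreal a * (\<integral>\<^sup>+t. indicator {t. 0 < t \<and> t < 1 \<and> ennreal (a * t) < y} t \<partial>lborel)"
proof (cases y)
  case (real u)
  have "{t. 0 < t \<and> t < 1 \<and> ennreal (a * t) < y} = {0<..<min 1 (u / a)}"
    using real a by (auto simp: ennreal_less_iff field_simps)
  moreover have "ennreal a * ennreal (min 1 (u / a)) = min y (ennreal a)"
    using real a by (simp add: ennreal_mult[symmetric] min_def field_simps ennreal_leI)
  ultimately show ?thesis using real a by simp
next
  case top
  have "{t. 0 < t \<and> t < 1 \<and> ennreal (a * t) < y} = {0<..<1}" using top by auto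
  with top show ?thesis by (simp add: min_absorb2)
qed

text \<open>Levels are rescaled to the unit interval so that functions with different suprema can be
  compared at the same \<open>t\<close>. Truncation at \<open>a\<close> changes nothing when
  \<open>a\<close> bounds \<open>f\<close>, and otherwise gives a lower bound for the
  integral.\<close>

lemma nn_integral_min_eq_layer:
  fixes f :: "real \<Rightarrow> ennreal"
  assumes a: "0 < a" and [measurable]: "f \<in> borel_measurable borel"
  shows "(\<integral>\<^sup>+x. min (f x) (ennreal a) \<partial>lborel)
    = ennreal a * (\<integral>\<^sup>+t. indicator {0<..<1} t * emeasure lborel {x. ennreal (a * t) < f x} \<partial>lborel)"
proof -
  let ?I = "\<lambda>x t. indicator {t. 0 < t \<and> t < 1 \<and> ennreal (a * t) < f x} t :: ennreal"
  have m: "(\<lambda>(x, t). ?I x t) \<in> borel_measurable (lborel \<Otimes>\<^sub>M lborel)"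
    unfolding indicator_def by simp
  have m1: "(\<lambda>x. \<integral>\<^sup>+t. ?I x t \<partial>lborel) \<in> borel_measurable lborel"
    using lborel.borel_measurable_nn_integral_fst[OF m] by simp
  have "(\<integral>\<^sup>+x. min (f x) (ennreal a) \<partial>lborel) = (\<integral>\<^sup>+x. ennreal a * (\<integral>\<^sup>+t. ?I x t \<partial>lborel) \<partial>lborel)"
    using min_eq_layer_integral[OF a] by simp
  also have "\<dots> = ennreal a * (\<integral>\<^sup>+x. \<integral>\<^sup>+t. ?I x t \<partial>lborel \<partial>lborel)"
    using m1 by (rule nn_integral_cmult)
  also have "(\<integral>\<^sup>+x. \<integral>\<^sup>+t. ?I x t \<partial>lborel \<partial>lborel) = (\<integral>\<^sup>+t. \<integral>\<^sup>+x. ?I x t \<partial>lborel \<partial>lborel)"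
    using lborel_pair.Fubini[OF m] by simp
  also have "(\<lambda>t. \<integral>\<^sup>+x. ?I x t \<partial>lborel) = (\<lambda>t. indicator {0<..<1} t * emeasure lborel {x. ennreal (a * t) < f x})"
  proof
    fix t
    have "(\<integral>\<^sup>+x. ?I x t \<partial>lborel) = (\<integral>\<^sup>+x. indicator {0<..<1} t * indicator {x. ennreal (a * t) < f x} x \<partial>lborel)"
      by (intro nn_integral_cong) (auto simp: indicator_def)
    then show "(\<integral>\<^sup>+x. ?I x t \<partial>lborel) = indicator {0<..<1} t * emeasure lborel {x. ennreal (a * t) < f x}"
      by (simp add: nn_integral_cmult)
  qed
  finally show ?thesis .
qed

lemma ennreal_four_mult_le: "4 * (u * v) \<le> (u + v :: ennreal)\<^sup>2"
proof (cases "u = \<top> \<or> v = \<top>")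
  case True
  then show ?thesis by (auto simp: power2_eq_square ennreal_top_mult)
next
  case False
  then obtain x y where "u = ennreal x" "v = ennreal y" "x \<ge> 0" "y \<ge> 0"
    by (metis ennreal_cases)
  moreover have "4 * (x * y) \<le> (x + y)\<^sup>2"
    using zero_le_power2[of "x - y"] by (simp add: power2_eq_square algebra_simps)
  ultimately show ?thesis
    by (simp flip: ennreal_numeral ennreal_mult ennreal_plus add: ennreal_power ennreal_leI)
qed

lemma ennreal_mult_strict_mono_both:
  assumes "ennreal u < p" "ennreal v < q" "0 \<le> u" "0 \<le> v"
  shows "ennreal u * ennreal v < p * q"
proof -
  have "0 < p" "0 < q" using assms by (auto intro: le_less_trans)
  show ?thesis
  proof (cases "p = \<top> \<or> q = \<top>")
    case True
    with \<open>0 < p\<close> \<open>0 < q\<close> show ?thesis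
      by (auto simp: ennreal_top_mult ennreal_mult_top ennreal_mult_less_top)
  next
    case False
    then obtain x y where "p = ennreal x" "q = ennreal y" "x \<ge> 0" "y \<ge> 0"
      by (metis ennreal_cases)
    with assms show ?thesis
      by (auto simp: ennreal_mult[symmetric] ennreal_less_iff intro!: mult_strict_mono)
  qed
qed

text \<open>With \<open>a\<close>, \<open>b\<close> the suprema of \<open>f\<close>,
  \<open>g\<close> and \<open>c = sqrt (a * b)\<close>, the level sets at heights
  \<open>a * t\<close>, \<open>b * t\<close>, \<open>c * t\<close> satisfy the hypothesis of
  Brunn-Minkowski for each \<open>t\<close>. Integrating in \<open>t\<close> bounds
  \<open>c * (u + v)\<close> by twice the integral of \<open>h\<close>, and
  \<open>4 * (u * v) \<le> (u + v)^2\<close> turns the sum into the required product.\<close>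

lemma prekopa_midpoint_real:
  fixes f g h :: "real \<Rightarrow> ennreal"
  assumes [measurable]: "f \<in> borel_measurable borel" "g \<in> borel_measurable borel" "h \<in> borel_measurable borel"
    and bnd: "\<And>x. f x \<le> C" "\<And>x. g x \<le> C" "C < \<top>"
    and mid: "\<And>x y. f x * g y \<le> (h ((x + y) / 2))\<^sup>2"
  shows "(\<integral>\<^sup>+x. f x \<partial>lborel) * (\<integral>\<^sup>+x. g x \<partial>lborel) \<le> (\<integral>\<^sup>+x. h x \<partial>lborel)\<^sup>2"
proof (cases "(SUP x. f x) = 0 \<or> (SUP x. g x) = 0")
  case True
  then have "(\<forall>x. f x = 0) \<or> (\<forall>x. g x = 0)" by (auto simp: SUP_eq_iff bot_ennreal)
  then show ?thesis by auto
next
  case False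
  have "(SUP x. f x) < \<top>" "(SUP x. g x) < \<top>"
    using bnd by (auto intro: le_less_trans[OF SUP_least])
  then obtain a b where ab: "(SUP x. f x) = ennreal a" "(SUP x. g x) = ennreal b" "a > 0" "b > 0"
    using False by (metis ennreal_cases ennreal_0 less_irrefl order_le_less top.not_eq_extremum)
  define c where "c = sqrt (a * b)"
  have c: "c > 0" "c * c = a * b" using ab by (auto simp: c_def)
  define F where "F t = emeasure lborel {x. ennreal (a * t) < f x}" for t
  define G where "G t = emeasure lborel {x. ennreal (b * t) < g x}" for t
  define H where "H t = emeasure lborel {x. ennreal (c * t) < h x}" for t
  have [measurable]: "F \<in> borel_measurable borel" "G \<in> borel_measurable borel" "H \<in> borel_measurable borel"
    unfolding F_def G_def H_def by measurable
  define u v where "u = (\<integral>\<^sup>+t. indicator {0<..<1} t * F t \<partial>lborel)"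
    and "v = (\<integral>\<^sup>+t. indicator {0<..<1} t * G t \<partial>lborel)"
  have "(\<integral>\<^sup>+x. f x \<partial>lborel) = ennreal a * u"
    using nn_integral_min_eq_layer[OF ab(3), of f] SUP_upper[of _ UNIV f] ab(1)
    by (simp add: u_def F_def min_absorb1)
  moreover have "(\<integral>\<^sup>+x. g x \<partial>lborel) = ennreal b * v"
    using nn_integral_min_eq_layer[OF ab(4), of g] SUP_upper[of _ UNIV g] ab(2)
    by (simp add: v_def G_def min_absorb1)
  moreover have "ennreal c * (u + v) \<le> 2 * (\<integral>\<^sup>+x. h x \<partial>lborel)"
  proof -
    have FGH: "indicator {0<..<1} t * F t + indicator {0<..<1} t * G t \<le> 2 * (indicator {0<..<1} t * H t)" for t :: real
    proof (cases "t \<in> {0<..<1}")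
      case True
      have "F t + G t \<le> 2 * H t"
        unfolding F_def G_def H_def
      proof (rule brunn_minkowski_midpoint_real)
        \<comment> \<open>Because \<open>t < 1\<close>, both levels lie strictly below the suprema
          and the level sets are nonempty; for an empty set the Brunn-Minkowski inequality
          fails.\<close>
        have "ennreal (a * t) < ennreal a" "ennreal (b * t) < ennreal b"
          using ab True by (auto simp: ennreal_less_iff)
        then show "{x. ennreal (a * t) < f x} \<noteq> {}" "{x. ennreal (b * t) < g x} \<noteq> {}"
          unfolding ab(1)[symmetric] ab(2)[symmetric] by (auto simp: less_SUP_iff)
      next
        fix x y assume "x \<in> {x. ennreal (a * t) < f x}" "y \<in> {x. ennreal (b * t) < g x}"
        then have "ennreal (a * t) < f x" "ennreal (b * t) < g y" by auto
        then have "ennreal (a * t) * ennreal (b * t) < f x * g y"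
          using ab True by (intro ennreal_mult_strict_mono_both) auto
        also have "\<dots> \<le> (h ((x + y) / 2))\<^sup>2" by (rule mid)
        also have "ennreal (a * t) * ennreal (b * t) = (ennreal (c * t))\<^sup>2"
          using ab c True by (simp add: power2_eq_square ennreal_mult[symmetric] algebra_simps)
        finally show "(x + y) / 2 \<in> {x. ennreal (c * t) < h x}"
          using power_mono[of "h ((x + y) / 2)" "ennreal (c * t)" 2] by (auto simp: not_le[symmetric])
      qed auto
      with True show ?thesis by simp
    qed auto
    have "u + v = (\<integral>\<^sup>+t. indicator {0<..<1} t * F t + indicator {0<..<1} t * G t \<partial>lborel)"
      unfolding u_def v_def by (subst nn_integral_add) auto
    also have "\<dots> \<le> (\<integral>\<^sup>+t. 2 * (indicator {0<..<1} t * H t) \<partial>lborel)"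
      by (intro nn_integral_mono FGH)
    also have "\<dots> = 2 * (\<integral>\<^sup>+t. indicator {0<..<1} t * H t \<partial>lborel)"
      by (rule nn_integral_cmult) auto
    finally have "ennreal c * (u + v) \<le> 2 * (ennreal c * (\<integral>\<^sup>+t. indicator {0<..<1} t * H t \<partial>lborel))"
      by (metis mult.left_commute mult_left_mono zero_le)
    also have "ennreal c * (\<integral>\<^sup>+t. indicator {0<..<1} t * H t \<partial>lborel) = (\<integral>\<^sup>+x. min (h x) (ennreal c) \<partial>lborel)"
      using nn_integral_min_eq_layer[OF c(1), of h] by (simp add: H_def)
    also have "\<dots> \<le> (\<integral>\<^sup>+x. h x \<partial>lborel)" by (intro nn_integral_mono) auto
    finally show ?thesis by (simp add: mult_left_mono)
  qed
  ultimately show ?thesis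
  proof -
    assume f: "(\<integral>\<^sup>+x. f x \<partial>lborel) = ennreal a * u" and g: "(\<integral>\<^sup>+x. g x \<partial>lborel) = ennreal b * v"
      and h: "ennreal c * (u + v) \<le> 2 * (\<integral>\<^sup>+x. h x \<partial>lborel)"
    have "4 * ((ennreal a * u) * (ennreal b * v)) = (ennreal c)\<^sup>2 * (4 * (u * v))"
      using ab c by (simp add: power2_eq_square ennreal_mult[symmetric] mult_ac)
    also have "\<dots> \<le> (ennreal c)\<^sup>2 * (u + v)\<^sup>2" by (intro mult_left_mono ennreal_four_mult_le) auto
    also have "\<dots> = (ennreal c * (u + v))\<^sup>2" by (simp add: power_mult_distrib)
    also have "\<dots> \<le> (2 * (\<integral>\<^sup>+x. h x \<partial>lborel))\<^sup>2" using h by (intro power_mono) auto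
    also have "\<dots> = 4 * (\<integral>\<^sup>+x. h x \<partial>lborel)\<^sup>2" by (simp add: power_mult_distrib)
    finally show ?thesis unfolding f g by (simp add: ennreal_mult_le_mult_iff)
  qed
qed

text \<open>The Prekopa-Leindler inequality at the midpoint, as a property of the measure. The
  parameter \<open>mid\<close> covers numbers and tuples alike; the finite bound \<open>C\<close>
  makes the scaling by suprema possible.\<close>

definition log_concave_measure :: "'b measure \<Rightarrow> ('b \<Rightarrow> 'b \<Rightarrow> 'b) \<Rightarrow> bool" where
  "log_concave_measure N mid \<longleftrightarrow> (\<forall>f\<in>borel_measurable N. \<forall>g\<in>borel_measurable N. \<forall>h\<in>borel_measurable N. \<forall>C :: ennreal.
     C < \<top> \<longrightarrow> (\<forall>x. f x \<le> C \<and> g x \<le> C) \<longrightarrow>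
     (\<forall>x\<in>space N. \<forall>y\<in>space N. f x * g y \<le> (h (mid x y))\<^sup>2) \<longrightarrow>
     (\<integral>\<^sup>+x. f x \<partial>N) * (\<integral>\<^sup>+x. g x \<partial>N) \<le> (\<integral>\<^sup>+x. h x \<partial>N)\<^sup>2)"

lemma log_concave_measureD:
  assumes "log_concave_measure N mid"
    and "f \<in> borel_measurable N" "g \<in> borel_measurable N" "h \<in> borel_measurable N"
    and "C < \<top>" "\<And>x. f x \<le> C" "\<And>x. g x \<le> C"
    and "\<And>x y. x \<in> space N \<Longrightarrow> y \<in> space N \<Longrightarrow> f x * g y \<le> (h (mid x y))\<^sup>2"
  shows "(\<integral>\<^sup>+x. f x \<partial>N) * (\<integral>\<^sup>+x. g x \<partial>N) \<le> (\<integral>\<^sup>+x. h x \<partial>N)\<^sup>2"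
  using assms unfolding log_concave_measure_def by blast

text \<open>Point masses occur as laws of degenerate functionals and as the product over the empty
  index set.\<close>

lemma log_concave_return:
  assumes "mid a a = a" "a \<in> space N"
  shows "log_concave_measure (return N a) mid"
  unfolding log_concave_measure_def
proof safe
  fix f g h :: "_ \<Rightarrow> ennreal" and C :: ennreal
  assume "f \<in> borel_measurable (return N a)" "g \<in> borel_measurable (return N a)" "h \<in> borel_measurable (return N a)"
    and *: "\<forall>x\<in>space (return N a). \<forall>y\<in>space (return N a). f x * g y \<le> (h (mid x y))\<^sup>2"
  then have "integral\<^sup>N (return N a) f = f a" "integral\<^sup>N (return N a) g = g a" "integral\<^sup>N (return N a) h = h a"
    using assms by (auto intro!: nn_integral_return)
  with * assms show "integral\<^sup>N (return N a) f * integral\<^sup>N (return N a) g \<le> (integral\<^sup>N (return N a) h)\<^sup>2"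
    by (metis space_return)
qed

text \<open>The density is absorbed into the functions: its midpoint inequality multiplies with that
  of \<open>f\<close>, \<open>g\<close>, \<open>h\<close>, and its bound keeps the products
  bounded.\<close>

lemma log_concave_density_real:
  fixes d :: "real \<Rightarrow> real"
  assumes [measurable]: "d \<in> borel_measurable borel" and d0: "\<And>x. 0 \<le> d x" and dB: "\<And>x. d x \<le> B"
    and d: "\<And>x y. d x * d y \<le> (d ((x + y) / 2))\<^sup>2"
  shows "log_concave_measure (density lborel d) (\<lambda>x y. (x + y) / 2)"
  unfolding log_concave_measure_def
proof safe
  fix f g h :: "_ \<Rightarrow> ennreal" and C :: ennreal
  assume "f \<in> borel_measurable (density lborel d)" "g \<in> borel_measurable (density lborel d)" "h \<in> borel_measurable (density lborel d)"
  then have [measurable]: "f \<in> borel_measurable borel" "g \<in> borel_measurable borel" "h \<in> borel_measurable borel"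
    by simp_all
  assume C: "C < \<top>" "\<forall>x. f x \<le> C \<and> g x \<le> C"
    and *: "\<forall>x\<in>space (density lborel d). \<forall>y\<in>space (density lborel d). f x * g y \<le> (h ((x + y) / 2))\<^sup>2"
  have "(\<integral>\<^sup>+x. d x * f x \<partial>lborel) * (\<integral>\<^sup>+x. d x * g x \<partial>lborel) \<le> (\<integral>\<^sup>+x. d x * h x \<partial>lborel)\<^sup>2"
  proof (rule prekopa_midpoint_real)
    show "ennreal (d x) * f x \<le> ennreal B * C" "ennreal (d x) * g x \<le> ennreal B * C" for x
      using C dB by (auto intro!: mult_mono ennreal_leI)
    show "ennreal B * C < \<top>" using C by (simp add: ennreal_mult_less_top)
    fix x y
    have "(d x * f x) * (d y * g y) = ennreal (d x * d y) * (f x * g y)"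
      using d0 by (simp add: ennreal_mult mult_ac)
    also have "\<dots> \<le> ennreal ((d ((x + y) / 2))\<^sup>2) * (h ((x + y) / 2))\<^sup>2"
      using * d by (intro mult_mono ennreal_leI) auto
    also have "\<dots> = (d ((x + y) / 2) * h ((x + y) / 2))\<^sup>2"
      using d0 by (simp add: ennreal_power power_mult_distrib)
    finally show "(d x * f x) * (d y * g y) \<le> (d ((x + y) / 2) * h ((x + y) / 2))\<^sup>2" .
  qed simp_all
  then show "integral\<^sup>N (density lborel d) f * integral\<^sup>N (density lborel d) g \<le> (integral\<^sup>N (density lborel d) h)\<^sup>2"
    by (simp add: nn_integral_density)
qed

lemma log_concave_normal:
  assumes "\<sigma> > 0"
  shows "log_concave_measure (density lborel (normal_density \<mu> \<sigma>)) (\<lambda>x y. (x + y) / 2)"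
proof (rule log_concave_density_real)
  fix x y
  let ?k = "1 / sqrt (2 * pi * \<sigma>\<^sup>2)"
  show "normal_density \<mu> \<sigma> x \<le> ?k"
    unfolding normal_density_def by (intro mult_left_le) auto
  \<comment> \<open>Convexity of the square; the two sides differ by half the square of
    \<open>x - y\<close>.\<close>
  have q: "2 * ((x + y) / 2 - \<mu>)\<^sup>2 \<le> (x - \<mu>)\<^sup>2 + (y - \<mu>)\<^sup>2"
    using zero_le_power2[of "x - y"] by (simp add: power2_eq_square field_simps)
  have "exp (- (x - \<mu>)\<^sup>2 / (2 * \<sigma>\<^sup>2)) * exp (- (y - \<mu>)\<^sup>2 / (2 * \<sigma>\<^sup>2))
      = exp (- ((x - \<mu>)\<^sup>2 + (y - \<mu>)\<^sup>2) / (2 * \<sigma>\<^sup>2))"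
    by (simp flip: exp_add add: add_divide_distrib diff_divide_distrib)
  also have "\<dots> \<le> exp (- (2 * ((x + y) / 2 - \<mu>)\<^sup>2) / (2 * \<sigma>\<^sup>2))"
    using q assms by (intro exp_le_cancel_iff[THEN iffD2] divide_right_mono) auto
  also have "\<dots> = (exp (- ((x + y) / 2 - \<mu>)\<^sup>2 / (2 * \<sigma>\<^sup>2)))\<^sup>2"
    by (simp add: power2_eq_square flip: exp_add)
  finally have "?k\<^sup>2 * (exp (- (x - \<mu>)\<^sup>2 / (2 * \<sigma>\<^sup>2)) * exp (- (y - \<mu>)\<^sup>2 / (2 * \<sigma>\<^sup>2)))
      \<le> ?k\<^sup>2 * (exp (- ((x + y) / 2 - \<mu>)\<^sup>2 / (2 * \<sigma>\<^sup>2)))\<^sup>2"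
    by (rule mult_left_mono) simp
  then show "normal_density \<mu> \<sigma> x * normal_density \<mu> \<sigma> y \<le> (normal_density \<mu> \<sigma> ((x + y) / 2))\<^sup>2"
    unfolding normal_density_def power_mult_distrib by (simp add: power2_eq_square mult_ac)
qed simp_all

text \<open>The midpoint of extensional functions is again extensional, since \<open>(u + u) / 2 = u\<close>
  also for \<open>u = undefined\<close>.\<close>

lemma log_concave_PiM:
  fixes N :: "'i \<Rightarrow> real measure"
  assumes "finite I"
    and prob: "\<And>i. prob_space (N i)"
    and sets_N: "\<And>i. sets (N i) = sets borel"
    and lc: "\<And>i. log_concave_measure (N i) (\<lambda>x y. (x + y) / 2)"
  shows "log_concave_measure (PiM I N) (\<lambda>x y i. (x i + y i) / 2)"
  using \<open>finite I\<close>
proof induction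
  case empty
  have "PiM {} N = return (PiM {} N) (\<lambda>_. undefined)"
    by (rule measure_eqI)
      (auto simp: PiM_empty emeasure_count_space indicator_def card_Suc_eq sets_PiM_empty subset_singleton_iff)
  moreover have "log_concave_measure (return (PiM {} N) (\<lambda>_. undefined)) (\<lambda>x y i. (x i + y i) / 2)"
    by (rule log_concave_return) auto
  ultimately show ?case by simp
next
  case (insert i I)
  interpret N: product_sigma_finite N
    using prob by (simp add: product_sigma_finite_def prob_space_imp_sigma_finite)
  interpret Ni: prob_space "N i" by (rule prob)
  show ?case
    unfolding log_concave_measure_def
  proof safe
    fix f g h :: "_ \<Rightarrow> ennreal" and C :: ennreal
    assume meas[measurable]: "f \<in> borel_measurable (PiM (insert i I) N)" "g \<in> borel_measurable (PiM (insert i I) N)"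
        "h \<in> borel_measurable (PiM (insert i I) N)"
      and C: "C < \<top>" "\<forall>x. f x \<le> C \<and> g x \<le> C"
      and *: "\<forall>x\<in>space (PiM (insert i I) N). \<forall>y\<in>space (PiM (insert i I) N). f x * g y \<le> (h (\<lambda>i. (x i + y i) / 2))\<^sup>2"
    \<comment> \<open>The bound passes unchanged to the fibre integrals because \<open>N i\<close>
      has mass one.\<close>
    have bnd: "(\<integral>\<^sup>+y. k (x(i := y)) \<partial>N i) \<le> C" if "\<And>x. k x \<le> C" for k x
    proof -
      have "(\<integral>\<^sup>+y. k (x(i := y)) \<partial>N i) \<le> (\<integral>\<^sup>+y. C \<partial>N i)" using that by (intro nn_integral_mono) auto
      then show ?thesis by (simp add: Ni.emeasure_space_1)
    qed
    have m: "(\<lambda>x. \<integral>\<^sup>+y. k (x(i := y)) \<partial>N i) \<in> borel_measurable (PiM I N)"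
      if [measurable]: "k \<in> borel_measurable (PiM (insert i I) N)" for k :: "_ \<Rightarrow> ennreal"
      by measurable
    have "(\<integral>\<^sup>+x. \<integral>\<^sup>+y. f (x(i := y)) \<partial>N i \<partial>PiM I N) * (\<integral>\<^sup>+x. \<integral>\<^sup>+y. g (x(i := y)) \<partial>N i \<partial>PiM I N)
        \<le> (\<integral>\<^sup>+x. \<integral>\<^sup>+y. h (x(i := y)) \<partial>N i \<partial>PiM I N)\<^sup>2"
    \<comment> \<open>The induction hypothesis is used on the integrals over coordinate
      \<open>i\<close>. Its midpoint condition, for fixed \<open>x\<close> and \<open>x'\<close>, is
      log-concavity of the single factor \<open>N i\<close>.\<close>
    proof (rule log_concave_measureD[OF insert.IH m[OF meas(1)] m[OF meas(2)] m[OF meas(3)] C(1)])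
      fix x x' assume x: "x \<in> space (PiM I N)" "x' \<in> space (PiM I N)"
      have m2: "(\<lambda>y. k (z(i := y))) \<in> borel_measurable (N i)"
        if [measurable]: "k \<in> borel_measurable (PiM (insert i I) N)" and [measurable]: "z \<in> space (PiM I N)" for k :: "_ \<Rightarrow> ennreal" and z
        by measurable
      have mx: "(\<lambda>i. (x i + x' i) / 2) \<in> space (PiM I N)" 
        using x sets_eq_imp_space_eq[OF sets_N] by (auto simp: space_PiM PiE_def extensional_def)
      show "(\<integral>\<^sup>+y. f (x(i := y)) \<partial>N i) * (\<integral>\<^sup>+y. g (x'(i := y)) \<partial>N i)
        \<le> (\<integral>\<^sup>+y. h ((\<lambda>i. (x i + x' i) / 2)(i := y)) \<partial>N i)\<^sup>2"
      proof (rule log_concave_measureD[OF lc m2[OF meas(1) x(1)] m2[OF meas(2) x(2)] m2[OF meas(3) mx] C(1)])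
        fix y y' assume y: "y \<in> space (N i)" "y' \<in> space (N i)"
        have "x(i := y) \<in> space (PiM (insert i I) N)" "x'(i := y') \<in> space (PiM (insert i I) N)"
          using x y by (auto simp: space_PiM PiE_def extensional_def Pi_def)
        moreover have "(\<lambda>j. ((x(i := y)) j + (x'(i := y')) j) / 2) = (\<lambda>i. (x i + x' i) / 2)(i := (y + y') / 2)"
          by auto
        ultimately show "f (x(i := y)) * g (x'(i := y')) \<le> (h ((\<lambda>i. (x i + x' i) / 2)(i := (y + y') / 2)))\<^sup>2"
          using * by metis
      qed (use C in auto)
    qed (use C bnd in auto)
    then show "integral\<^sup>N (PiM (insert i I) N) f * integral\<^sup>N (PiM (insert i I) N) g \<le> (integral\<^sup>N (PiM (insert i I) N) h)\<^sup>2"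
      using insert.hyps meas by (simp add: N.product_nn_integral_insert)
  qed
qed

section \<open>Gaussian measures: uncorrelated functionals are independent\<close>

text \<open>The law of \<open>X\<close> under the density \<open>(2 + Z) / (2 + c)\<close> is a probability measure with the same
  characteristic function as \<open>X\<close>, so uniqueness of characteristic functions applies; the shift
  by \<open>2\<close> makes the density positive.\<close>

lemma (in prob_space) integral_indicator_mult_eq_of_char:
  fixes Z :: "'a \<Rightarrow> real"
  assumes [measurable]: "X \<in> borel_measurable M" "Z \<in> borel_measurable M" "A \<in> sets borel"
    and Z: "\<And>x. \<bar>Z x\<bar> \<le> 1"
    and eq: "\<And>s. (\<integral>x. iexp (s * X x) * Z x \<partial>M) = (\<integral>x. iexp (s * X x) \<partial>M) * complex_of_real c"
  shows "(\<integral>x. indicator A (X x) * Z x \<partial>M) = prob (X -` A \<inter> space M) * c"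
proof -
  have intZ: "integrable M Z" using Z by (intro integrable_const_bound[where B = 1]) auto
  have intI: "integrable M (\<lambda>x. iexp (s * X x))" for s
    by (intro integrable_const_bound[where B = 1]) auto
  have intIZ: "integrable M (\<lambda>x. iexp (s * X x) * Z x)" for s
    using Z by (intro integrable_const_bound[where B = 1]) (auto simp: norm_mult)
  \<comment> \<open>Frequency \<open>0\<close> identifies \<open>c\<close> as the mean of
    \<open>Z\<close>, so that \<open>(2 + Z) / (2 + c)\<close> integrates to one.\<close>
  have "complex_of_real (expectation Z) = complex_of_real c"
    using eq[of 0] by (simp add: prob_space)
  then have EZ: "expectation Z = c"
    by (simp only: of_real_eq_iff)
  have "\<bar>c\<bar> \<le> expectation (\<lambda>x. \<bar>Z x\<bar>)"
    unfolding EZ[symmetric] by (rule integral_abs_bound)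
  also have "\<dots> \<le> 1"
    using Z intZ by (intro integral_le_const) auto
  finally have c: "2 + c > 0" by simp
  define w where "w x = (2 + Z x) / (2 + c)" for x
  have [measurable]: "w \<in> borel_measurable M" unfolding w_def by measurable
  have w0: "w x \<ge> 0" for x using Z[of x] c by (simp add: w_def abs_le_iff)
  have intw: "integrable M w" unfolding w_def using intZ by simp
  have "expectation w = 1"
    using intZ c unfolding w_def by (simp add: EZ prob_space)
  then have "prob_space (density M w)"
    using w0 intw by (intro prob_spaceI) (simp add: emeasure_density nn_integral_eq_integral)
  then interpret N: prob_space "density M w" .
  define D where "D = distr (density M w) borel X"
  have "D = distr M borel X"
  proof (rule Levy_uniqueness)
    show "real_distribution D"
      unfolding D_def by (intro real_distribution.intro N.prob_space_distr real_distribution_axioms.intro) auto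
    show "real_distribution (distr M borel X)"
      by (intro real_distribution.intro prob_space_distr real_distribution_axioms.intro) auto
    show "char D = char (distr M borel X)"
    proof
      fix s
      have "char D s = (\<integral>x. iexp (s * X x) \<partial>density M w)"
        unfolding D_def char_def by (subst integral_distr) auto
      also have "\<dots> = (\<integral>x. w x *\<^sub>R iexp (s * X x) \<partial>M)"
        using w0 by (subst integral_density) auto
      also have "\<dots> = (\<integral>x. (2 * iexp (s * X x) + iexp (s * X x) * Z x) / complex_of_real (2 + c) \<partial>M)"
        by (simp add: w_def scaleR_conv_of_real algebra_simps)
      also have "\<dots> = (2 * (\<integral>x. iexp (s * X x) \<partial>M) + (\<integral>x. iexp (s * X x) * Z x \<partial>M)) / complex_of_real (2 + c)"
        using intI intIZ by simp
      also have "\<dots> = (\<integral>x. iexp (s * X x) \<partial>M) * complex_of_real (2 + c) / complex_of_real (2 + c)"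
        unfolding eq by (simp add: algebra_simps)
      also have "\<dots> = (\<integral>x. iexp (s * X x) \<partial>M)"
        using c by (metis less_irrefl nonzero_mult_div_cancel_right of_real_eq_0_iff)
      finally show "char D s = char (distr M borel X) s"
        unfolding char_def by (subst integral_distr) auto
    qed
  qed
  then have "measure D A = prob (X -` A \<inter> space M)"
    by (simp add: measure_distr)
  moreover have "measure D A = (\<integral>x. indicator A (X x) * w x \<partial>M)"
  proof -
    have "measure D A = (\<integral>x. indicator A x \<partial>D)" unfolding D_def by simp
    also have "\<dots> = (\<integral>x. indicator A (X x) \<partial>density M w)" unfolding D_def by (subst integral_distr) auto
    also have "\<dots> = (\<integral>x. indicator A (X x) * w x \<partial>M)"
      using w0 by (subst integral_density) (auto simp: mult.commute)
    finally show ?thesis .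
  qed
  moreover have "(\<integral>x. indicator A (X x) * w x \<partial>M)
      = (2 * prob (X -` A \<inter> space M) + (\<integral>x. indicator A (X x) * Z x \<partial>M)) / (2 + c)"
  proof -
    have i1: "integrable M (\<lambda>x. indicator A (X x) :: real)"
      by (intro integrable_const_bound[where B = 1]) (auto simp: indicator_def)
    have i2: "integrable M (\<lambda>x. indicator A (X x) * Z x)"
      using Z by (intro integrable_const_bound[where B = 1]) (auto simp: indicator_def)
    have "(\<lambda>x. indicator A (X x) * w x) = (\<lambda>x. (2 * indicator A (X x) + indicator A (X x) * Z x) / (2 + c))"
      by (simp add: w_def algebra_simps)
    moreover have "(\<integral>x. indicator A (X x) \<partial>M) = prob (X -` A \<inter> space M)"
    proof -
      have "(\<integral>x. indicator A (X x) \<partial>M) = (\<integral>x. indicator (X -` A \<inter> space M) x \<partial>M :: real)"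
        by (intro Bochner_Integration.integral_cong) (auto simp: indicator_def)
      then show ?thesis by simp
    qed
    ultimately show ?thesis using i1 i2 by simp
  qed
  ultimately show ?thesis using c by (simp add: field_simps)
qed

text \<open>Real and imaginary parts are treated separately. \<open>Re Z\<close> is the average of
  \<open>Z\<close> and its conjugate, and conjugating the hypothesis at \<open>- s\<close> supplies
  the hypothesis for \<open>cnj Z\<close>. The imaginary part is the real part after multiplication
  by \<open>- \<i>\<close>.\<close>

lemma (in prob_space) complex_integral_indicator_mult_eq_of_char:
  fixes Z :: "'a \<Rightarrow> complex" and c :: complex
  assumes [measurable]: "X \<in> borel_measurable M" "Z \<in> borel_measurable M" "A \<in> sets borel"
    and Z: "\<And>x. norm (Z x) \<le> 1"
    and eq: "\<And>s. (\<integral>x. iexp (s * X x) * Z x \<partial>M) = (\<integral>x. iexp (s * X x) \<partial>M) * c"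
  shows "(\<integral>x. indicator A (X x) * Z x \<partial>M) = prob (X -` A \<inter> space M) * c"
proof -
  have Re: "(\<integral>x. indicator A (X x) * Re (W x) \<partial>M) = prob (X -` A \<inter> space M) * Re d"
    if [measurable]: "W \<in> borel_measurable M" and W: "\<And>x. norm (W x) \<le> 1"
      and d: "\<And>s. (\<integral>x. iexp (s * X x) * W x \<partial>M) = (\<integral>x. iexp (s * X x) \<partial>M) * d" for W d
  proof (rule integral_indicator_mult_eq_of_char)
    show "\<bar>Re (W x)\<bar> \<le> 1" for x using W[of x] abs_Re_le_cmod[of "W x"] by simp
    fix s
    have [measurable]: "(\<lambda>x. cnj (W x)) \<in> borel_measurable M"
      by (rule borel_measurable_continuous_on[of cnj, OF _ that(1)]) (intro continuous_intros)
    have i: "integrable M (\<lambda>x. iexp (s * X x) * W x)" "integrable M (\<lambda>x. iexp (s * X x) * cnj (W x))" for s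
      using W by (auto intro!: integrable_const_bound[where B = 1] simp: norm_mult)
    have cnj_iexp: "cnj (iexp (t * u)) = iexp ((- t) * u)" for t u
      by (simp add: exp_cnj)
    have "(\<integral>x. iexp (s * X x) * cnj (W x) \<partial>M) = cnj (\<integral>x. iexp ((- s) * X x) * W x \<partial>M)"
      unfolding Bochner_Integration.integral_cnj[symmetric] complex_cnj_mult cnj_iexp by simp
    also have "\<dots> = (\<integral>x. iexp (s * X x) \<partial>M) * cnj d"
      unfolding d complex_cnj_mult Bochner_Integration.integral_cnj[symmetric] cnj_iexp by simp
    finally have 1: "(\<integral>x. iexp (s * X x) * cnj (W x) \<partial>M) = (\<integral>x. iexp (s * X x) \<partial>M) * cnj d" .
    have reW: "complex_of_real (Re z) = (z + cnj z) / 2" for z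
      by (simp add: complex_add_cnj)
    have "(\<integral>x. iexp (s * X x) * complex_of_real (Re (W x)) \<partial>M)
        = (\<integral>x. (iexp (s * X x) * W x + iexp (s * X x) * cnj (W x)) / 2 \<partial>M)"
      unfolding reW by (simp add: algebra_simps)
    also have "\<dots> = ((\<integral>x. iexp (s * X x) * W x \<partial>M) + (\<integral>x. iexp (s * X x) * cnj (W x) \<partial>M)) / 2"
      using i by simp
    also have "\<dots> = (\<integral>x. iexp (s * X x) \<partial>M) * complex_of_real (Re d)"
      unfolding 1 d reW by (simp add: algebra_simps)
    finally show "(\<integral>x. iexp (s * X x) * complex_of_real (Re (W x)) \<partial>M)
        = (\<integral>x. iexp (s * X x) \<partial>M) * complex_of_real (Re d)" .
  qed measurable
  have int: "integrable M (\<lambda>x. indicator A (X x) * Z x)"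
    using Z by (intro integrable_const_bound[where B = 1]) (auto simp: indicator_def)
  have ri: "Re (indicator A y * z) = indicator A y * Re z" "Im (indicator A y * z) = indicator A y * Im z" for y z
    by (auto simp: indicator_def)
  have "Re (\<integral>x. indicator A (X x) * Z x \<partial>M) = prob (X -` A \<inter> space M) * Re c"
    using Re[OF assms(2) Z eq] unfolding integral_Re[OF int, symmetric] ri by simp
  moreover have "Im (\<integral>x. indicator A (X x) * Z x \<partial>M) = prob (X -` A \<inter> space M) * Im c"
  proof -
    have "(\<integral>x. indicator A (X x) * Re (- \<i> * Z x) \<partial>M) = prob (X -` A \<inter> space M) * Re (- \<i> * c)"
    proof (rule Re)
      show "(\<integral>x. iexp (s * X x) * (- \<i> * Z x) \<partial>M) = (\<integral>x. iexp (s * X x) \<partial>M) * (- \<i> * c)" for s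
        using eq[of s] by (simp add: mult.left_commute[of _ "- \<i>"] mult.left_commute[of _ "\<i>"])
    qed (use Z in \<open>auto simp: norm_mult\<close>)
    then show ?thesis unfolding integral_Im[OF int, symmetric] ri by simp
  qed
  ultimately show ?thesis by (simp add: complex_eq_iff)
qed

section \<open>Covariances and characteristic functions of bounded functionals\<close>

locale gaussian_space =
  fixes M :: "'a::{banach, second_countable_topology} measure"
  assumes gaussian: "centered_gaussian_measure M"

sublocale gaussian_space \<subseteq> prob_space M
  using gaussian by (simp add: centered_gaussian_measure_def)

context gaussian_space
begin

lemma sets_eq_borel [measurable_cong, simp]: "sets M = sets borel"
  using gaussian by (simp add: centered_gaussian_measure_def)

lemma space_eq_UNIV [simp]: "space M = UNIV"
  using sets_eq_imp_space_eq[OF sets_eq_borel] by simp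

lemma prob_UNIV [simp]: "prob UNIV = 1"
  using prob_space by simp

lemma borel_measurable_bounded_linear:
  "bounded_linear \<phi> \<Longrightarrow> \<phi> \<in> borel_measurable M" for \<phi> :: "'a \<Rightarrow> real"
  using borel_measurable_continuous_onI[OF linear_continuous_on] measurable_cong_sets[OF sets_eq_borel refl]
  by blast

definition cov :: "('a \<Rightarrow> real) \<Rightarrow> ('a \<Rightarrow> real) \<Rightarrow> real" where
  "cov \<phi> \<psi> = (\<integral>x. \<phi> x * \<psi> x \<partial>M)"

lemma bounded_linear_distr_cases:
  fixes \<phi> :: "'a \<Rightarrow> real"
  assumes "bounded_linear \<phi>"
  obtains "distr M borel \<phi> = return borel 0" "AE x in M. \<phi> x = 0"
  | \<sigma> where "\<sigma> > 0" "distr M borel \<phi> = density lborel (normal_density 0 \<sigma>)"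
      "distributed M lborel \<phi> (normal_density 0 \<sigma>)"
proof -
  note [measurable] = borel_measurable_bounded_linear[OF assms]
  obtain \<sigma> where \<sigma>: "\<sigma> \<ge> 0"
    "distr M borel \<phi> = (if \<sigma> = 0 then return borel 0 else density lborel (normal_density 0 \<sigma>))"
    using gaussian assms by (auto simp: centered_gaussian_measure_def)
  show ?thesis
  proof (cases "\<sigma> = 0")
    case True
    then have d: "distr M borel \<phi> = return borel 0" using \<sigma> by simp
    have "AE y in distr M borel \<phi>. y = 0" unfolding d by (subst AE_return) auto
    then have "AE x in M. \<phi> x = 0" by (subst (asm) AE_distr_iff) auto
    with d that show ?thesis by blast
  next
    case False
    with \<sigma> have d: "\<sigma> > 0" "distr M borel \<phi> = density lborel (normal_density 0 \<sigma>)" by auto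
    have "distributed M lborel \<phi> (normal_density 0 \<sigma>)"
      unfolding distributed_def using d by (auto simp: distr_def cong: distr_cong)
    with d that show ?thesis by blast
  qed
qed

text \<open>Frequency one is enough, since every multiple of a functional is again a
  functional.\<close>

lemma
  fixes \<phi> :: "'a \<Rightarrow> real"
  assumes "bounded_linear \<phi>"
  shows integrable_square: "integrable M (\<lambda>x. (\<phi> x)\<^sup>2)"
    and char_bounded_linear: "(\<integral>x. iexp (\<phi> x) \<partial>M) = exp (- cov \<phi> \<phi> / 2)"
proof -
  note [measurable] = borel_measurable_bounded_linear[OF assms]
  have "integrable M (\<lambda>x. (\<phi> x)\<^sup>2) \<and> (\<integral>x. iexp (\<phi> x) \<partial>M) = exp (- cov \<phi> \<phi> / 2)"
  proof (cases rule: bounded_linear_distr_cases[OF assms])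
    case 1
    have "integrable M (\<lambda>x. (\<phi> x)\<^sup>2) \<longleftrightarrow> integrable M (\<lambda>x. 0 :: real)"
      using 1 by (intro integrable_cong_AE) auto
    moreover have "cov \<phi> \<phi> = (\<integral>x. 0 \<partial>M)"
      unfolding cov_def using 1 by (intro integral_cong_AE) auto
    moreover have "(\<integral>x. iexp (\<phi> x) \<partial>M) = (\<integral>x. 1 \<partial>M)"
      using 1 by (intro integral_cong_AE) auto
    ultimately show ?thesis by (simp add: prob_space)
  next
    case (2 \<sigma>)
    have "has_bochner_integral lborel (\<lambda>x. normal_density 0 \<sigma> x * x\<^sup>2) (\<sigma>\<^sup>2)"
      using normal_moment_even[OF 2(1), of 0 1] by (simp add: fact_numeral)
    then have i: "integrable (distr M borel \<phi>) (\<lambda>x. x\<^sup>2)" "(\<integral>x. x\<^sup>2 \<partial>distr M borel \<phi>) = \<sigma>\<^sup>2"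
      unfolding 2(2)
      by (auto simp: integrable_density integral_density has_bochner_integral_iff)
    have 3: "integrable M (\<lambda>x. (\<phi> x)\<^sup>2)" "cov \<phi> \<phi> = \<sigma>\<^sup>2"
      using i by (simp_all add: integrable_distr_eq integral_distr cov_def power2_eq_square)
    \<comment> \<open>Rescaling to the standard normal law: the characteristic function of
      \<open>\<phi>\<close> at \<open>1\<close> is that of \<open>\<phi> / \<sigma>\<close> at
      \<open>\<sigma>\<close>.\<close>
    have "distributed M lborel (\<lambda>x. \<phi> x / \<sigma>) std_normal_density"
      using 2(3) normal_standard_normal_convert[OF 2(1), of \<phi> 0] by simp
    then have "distr M borel (\<lambda>x. \<phi> x / \<sigma>) = std_normal_distribution"
      by (auto simp: distributed_def distr_def cong: distr_cong)
    then have "char (distr M borel (\<lambda>x. \<phi> x / \<sigma>)) \<sigma> = exp (- \<sigma>\<^sup>2 / 2)"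
      by (simp add: char_std_normal_distribution)
    moreover have "char (distr M borel (\<lambda>x. \<phi> x / \<sigma>)) \<sigma> = (\<integral>x. iexp (\<phi> x) \<partial>M)"
      using 2(1) unfolding char_def by (subst integral_distr) auto
    ultimately show ?thesis using 3 by simp
  qed
  then show "integrable M (\<lambda>x. (\<phi> x)\<^sup>2)" "(\<integral>x. iexp (\<phi> x) \<partial>M) = exp (- cov \<phi> \<phi> / 2)" by auto
qed

lemma integrable_mult_bounded_linear:
  assumes "bounded_linear \<phi>" "bounded_linear \<psi>"
  shows "integrable M (\<lambda>x. \<phi> x * \<psi> x :: real)"
proof (rule Bochner_Integration.integrable_bound)
  note [measurable] = borel_measurable_bounded_linear[OF assms(1)] borel_measurable_bounded_linear[OF assms(2)]
  show "integrable M (\<lambda>x. (\<phi> x)\<^sup>2 + (\<psi> x)\<^sup>2)" using assms by (intro Bochner_Integration.integrable_add integrable_square)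
  show "(\<lambda>x. \<phi> x * \<psi> x) \<in> borel_measurable M" by measurable
  have "\<bar>a * b\<bar> \<le> a\<^sup>2 + b\<^sup>2" for a b :: real
  proof -
    have "2 * \<bar>a\<bar> * \<bar>b\<bar> \<le> \<bar>a\<bar>\<^sup>2 + \<bar>b\<bar>\<^sup>2" by (rule sum_squares_bound)
    moreover have "0 \<le> \<bar>a\<bar> * \<bar>b\<bar>" by simp
    ultimately show ?thesis unfolding abs_mult power2_abs by linarith
  qed
  then show "AE x in M. norm (\<phi> x * \<psi> x) \<le> norm ((\<phi> x)\<^sup>2 + (\<psi> x)\<^sup>2)"
    by simp
qed

lemma cov_commute: "cov \<phi> \<psi> = cov \<psi> \<phi>"
  by (simp add: cov_def mult.commute)

lemma cov_add_left:
  assumes "bounded_linear \<phi>" "bounded_linear \<phi>'" "bounded_linear \<psi>"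
  shows "cov (\<lambda>x. \<phi> x + \<phi>' x) \<psi> = cov \<phi> \<psi> + cov \<phi>' \<psi>"
  using assms unfolding cov_def by (simp add: distrib_right integrable_mult_bounded_linear)

lemma cov_diff_left:
  assumes "bounded_linear \<phi>" "bounded_linear \<phi>'" "bounded_linear \<psi>"
  shows "cov (\<lambda>x. \<phi> x - \<phi>' x) \<psi> = cov \<phi> \<psi> - cov \<phi>' \<psi>"
  using assms unfolding cov_def by (simp add: left_diff_distrib integrable_mult_bounded_linear)

lemma cov_scale_left: "cov (\<lambda>x. c * \<phi> x) \<psi> = c * cov \<phi> \<psi>"
  unfolding cov_def by (simp add: mult.assoc)

lemma cov_sum_left:
  assumes "\<And>i. i \<in> I \<Longrightarrow> bounded_linear (\<phi> i)" "bounded_linear \<psi>"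
  shows "cov (\<lambda>x. \<Sum>i\<in>I. \<phi> i x) \<psi> = (\<Sum>i\<in>I. cov (\<phi> i) \<psi>)"
  using assms unfolding cov_def by (simp add: sum_distrib_right integrable_mult_bounded_linear)

text \<open>Zero variance forces \<open>\<psi>\<close> to vanish almost everywhere. This covers the
  Gram-Schmidt step with denominator zero.\<close>

lemma cov_eq_0_of_self:
  assumes "bounded_linear \<phi>" "bounded_linear \<psi>" "cov \<psi> \<psi> = 0"
  shows "cov \<phi> \<psi> = 0"
proof -
  note [measurable] = borel_measurable_bounded_linear[OF assms(1)] borel_measurable_bounded_linear[OF assms(2)]
  have "AE x in M. \<psi> x * \<psi> x = 0"
    using assms(3) integrable_mult_bounded_linear[OF assms(2,2)] unfolding cov_def
    by (subst (asm) integral_nonneg_eq_0_iff_AE) auto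
  then have "cov \<phi> \<psi> = (\<integral>x. 0 \<partial>M)"
    unfolding cov_def by (intro integral_cong_AE) auto
  then show ?thesis by simp
qed

text \<open>The free functional \<open>\<phi>\<close> drives the induction. For a new index
  \<open>k\<close>, the multiple \<open>s * \<psi> k\<close> is added to \<open>\<phi>\<close> and
  the hypothesis for \<open>I\<close> is applied to the sum; holding for all \<open>s\<close>, the
  result is the characteristic function identity that lets the event for \<open>\<psi> k\<close> be
  split off.\<close>

lemma uncorrelated_joint_char:
  assumes "finite I"
    and "\<And>i. i \<in> I \<Longrightarrow> bounded_linear (\<psi> i)"
    and "\<And>i j. i \<in> I \<Longrightarrow> j \<in> I \<Longrightarrow> i \<noteq> j \<Longrightarrow> cov (\<psi> i) (\<psi> j) = 0"
    and "\<And>i. i \<in> I \<Longrightarrow> A i \<in> sets borel"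
    and "bounded_linear \<phi>" "\<And>i. i \<in> I \<Longrightarrow> cov \<phi> (\<psi> i) = 0"
  shows "(\<integral>x. complex_of_real (\<Prod>i\<in>I. indicator (A i) (\<psi> i x)) * iexp (\<phi> x) \<partial>M)
    = (\<Prod>i\<in>I. prob (\<psi> i -` A i)) * (\<integral>x. iexp (\<phi> x) \<partial>M)"
  using assms
proof (induction I arbitrary: \<phi> rule: finite_induct)
  case (insert k I)
  let ?P = "\<lambda>x. \<Prod>i\<in>I. indicator (A i) (\<psi> i x) :: real"
  let ?p = "\<Prod>i\<in>I. prob (\<psi> i -` A i)"
  have bl: "bounded_linear (\<psi> k)" "bounded_linear \<phi>" "\<And>i. i \<in> I \<Longrightarrow> bounded_linear (\<psi> i)" using insert.prems by auto
  note [measurable] = borel_measurable_bounded_linear[OF bl(1)] borel_measurable_bounded_linear[OF bl(2)]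
  have mi[measurable]: "\<And>i. i \<in> I \<Longrightarrow> \<psi> i \<in> borel_measurable M" "\<And>i. i \<in> I \<Longrightarrow> A i \<in> sets borel"
    using bl borel_measurable_bounded_linear insert.prems(3) by auto
  have Ak[measurable]: "A k \<in> sets borel" using insert.prems(3) by auto
  have P1: "\<bar>?P x\<bar> \<le> 1" for x
    unfolding abs_prod by (intro prod_le_1) (auto simp: indicator_def)
  have Pm[measurable]: "?P \<in> borel_measurable M"
  proof (rule borel_measurable_prod)
    fix i assume i: "i \<in> I"
    note [measurable] = mi[OF i]
    show "(\<lambda>x. indicator (A i) (\<psi> i x) :: real) \<in> borel_measurable M" by measurable
  qed
  have "(\<integral>x. indicator (A k) (\<psi> k x) * (complex_of_real (?P x) * iexp (\<phi> x)) \<partial>M)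
      = prob (\<psi> k -` A k \<inter> space M) * (?p * (\<integral>x. iexp (\<phi> x) \<partial>M))"
  proof (rule complex_integral_indicator_mult_eq_of_char[where X = "\<psi> k" and A = "A k"
        and Z = "\<lambda>x. complex_of_real (?P x) * iexp (\<phi> x)" and c = "complex_of_real ?p * (\<integral>x. iexp (\<phi> x) \<partial>M)"])
    show "norm (complex_of_real (?P x) * iexp (\<phi> x)) \<le> 1" for x
      using P1[of x] unfolding norm_mult norm_of_real by simp
    fix s :: real
    have bs: "bounded_linear (\<lambda>x. s * \<psi> k x)" using bl(1) by (rule bounded_linear_const_mult)
    have "(\<integral>x. iexp (s * \<psi> k x) * (complex_of_real (?P x) * iexp (\<phi> x)) \<partial>M)
        = (\<integral>x. complex_of_real (?P x) * iexp (s * \<psi> k x + \<phi> x) \<partial>M)"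
      by (simp add: exp_add algebra_simps)
    also have "\<dots> = ?p * (\<integral>x. iexp (s * \<psi> k x + \<phi> x) \<partial>M)"
    proof (rule insert.IH)
      show "cov (\<lambda>x. s * \<psi> k x + \<phi> x) (\<psi> i) = 0" if "i \<in> I" for i
        using that insert.prems insert.hyps bs bl
        by (subst cov_add_left) (auto simp: cov_scale_left)
    qed (use insert.prems bs in \<open>auto intro: bounded_linear_add\<close>)
    also have "(\<integral>x. iexp (s * \<psi> k x + \<phi> x) \<partial>M) = (\<integral>x. iexp (s * \<psi> k x) \<partial>M) * (\<integral>x. iexp (\<phi> x) \<partial>M)"
    proof -
      have bsp: "bounded_linear (\<lambda>x. s * \<psi> k x + \<phi> x)" using bs bl by (intro bounded_linear_add)
      have c0: "cov \<phi> (\<lambda>x. s * \<psi> k x) = 0"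
        using insert.prems(5)[of k] by (subst cov_commute) (simp add: cov_scale_left cov_commute)
      \<comment> \<open>The mixed covariance is zero, so variances add and the characteristic
        function of the sum factors.\<close>
      have "cov (\<lambda>x. s * \<psi> k x + \<phi> x) (\<lambda>x. s * \<psi> k x + \<phi> x)
          = cov (\<lambda>x. s * \<psi> k x) (\<lambda>x. s * \<psi> k x) + cov \<phi> \<phi>"
        using cov_add_left[OF bs bl(2) bsp] cov_add_left[OF bs bl(2) bs] cov_add_left[OF bs bl(2) bl(2)] c0
          cov_commute[of \<phi> "\<lambda>x. s * \<psi> k x"] cov_commute[of "\<lambda>x. s * \<psi> k x + \<phi> x" \<phi>]
          cov_commute[of "\<lambda>x. s * \<psi> k x + \<phi> x" "\<lambda>x. s * \<psi> k x"] by linarith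
      then show ?thesis
        unfolding char_bounded_linear[OF bsp] char_bounded_linear[OF bs] char_bounded_linear[OF bl(2)]
        by (simp add: add_divide_distrib flip: exp_add of_real_mult)
    qed
    finally show "(\<integral>x. iexp (s * \<psi> k x) * (complex_of_real (?P x) * iexp (\<phi> x)) \<partial>M)
        = (\<integral>x. iexp (s * \<psi> k x) \<partial>M) * (?p * (\<integral>x. iexp (\<phi> x) \<partial>M))"
      by (simp add: mult_ac)
  qed measurable
  moreover have "complex_of_real (indicator B y) = indicator B y" for B and y :: real
    by (simp add: indicator_def)
  ultimately show ?case using insert.hyps by (simp add: mult_ac)
qed simp

text \<open>With \<open>\<phi> = 0\<close>, \<open>uncorrelated_joint_char\<close> is the product
  formula on boxes, which determines the law. Outside \<open>I\<close> the factor is a point mass,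
  so that every index carries a probability measure.\<close>

lemma distr_uncorrelated_eq_PiM:
  assumes I: "finite I"
    and bl: "\<And>i. i \<in> I \<Longrightarrow> bounded_linear (\<psi> i)"
    and uc: "\<And>i j. i \<in> I \<Longrightarrow> j \<in> I \<Longrightarrow> i \<noteq> j \<Longrightarrow> cov (\<psi> i) (\<psi> j) = 0"
  shows "distr M (PiM I (\<lambda>_. borel)) (\<lambda>x. \<lambda>i\<in>I. \<psi> i x) = PiM I (\<lambda>i. if i \<in> I then distr M borel (\<psi> i) else return borel 0)"
    (is "?D = PiM I ?N")
proof -
  have m: "\<psi> i \<in> borel_measurable M" if "i \<in> I" for i
    using bl[OF that] by (rule borel_measurable_bounded_linear)
  have mD: "(\<lambda>x. \<lambda>i\<in>I. \<psi> i x) \<in> measurable M (PiM I (\<lambda>_. borel))"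
    using m by (intro measurable_restrict) auto
  have pr: "prob_space (?N i)" for i using m by (auto intro: prob_space_distr prob_space_return)
  then interpret N: product_sigma_finite ?N
    by (simp add: product_sigma_finite_def prob_space_imp_sigma_finite)
  show ?thesis
  proof (rule N.PiM_eqI[OF I])
    show "sets ?D = sets (PiM I ?N)" by (simp cong: sets_PiM_cong)
    fix A assume "\<And>i. i \<in> I \<Longrightarrow> A i \<in> sets (?N i)"
    then have A: "\<And>i. i \<in> I \<Longrightarrow> A i \<in> sets borel" by auto
    let ?S = "\<lambda>i. \<psi> i -` A i"
    have S: "?S i \<in> sets M" if "i \<in> I" for i
      using measurable_sets[OF m[OF that] A[OF that]] by simp
    let ?E = "(\<Inter>i\<in>I. ?S i) :: 'a set"
    have E: "?E \<in> sets M" 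
      using S I by (cases "I = {}") (auto intro!: sets.finite_INT)
    have "complex_of_real (prob ?E) = (\<integral>x. complex_of_real (indicator ?E x) \<partial>M)"
      using E by simp
    also have "\<dots> = (\<integral>x. complex_of_real (\<Prod>i\<in>I. indicator (A i) (\<psi> i x)) * iexp 0 \<partial>M)"
    proof (intro Bochner_Integration.integral_cong refl)
      fix x
      have "(\<Prod>i\<in>I. indicator (A i) (\<psi> i x)) = (indicator ?E x :: real)"
        using I by (induction I) (auto simp: indicator_def)
      then show "complex_of_real (indicator ?E x) = complex_of_real (\<Prod>i\<in>I. indicator (A i) (\<psi> i x)) * iexp 0"
        by simp
    qed
    also have "\<dots> = (\<Prod>i\<in>I. prob (?S i)) * (\<integral>x. iexp 0 \<partial>M)"
      by (rule uncorrelated_joint_char[OF I bl uc A bounded_linear_zero]) (auto simp: cov_def)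
    finally have "prob ?E = (\<Prod>i\<in>I. prob (?S i))"
      by (simp add: prob_space flip: of_real_prod)
    moreover have "emeasure ?D (Pi\<^sub>E I A) = emeasure M ?E"
    proof -
      have "emeasure ?D (Pi\<^sub>E I A) = emeasure M ((\<lambda>x. \<lambda>i\<in>I. \<psi> i x) -` Pi\<^sub>E I A \<inter> space M)"
        using A I by (intro emeasure_distr mD sets_PiM_I_finite) auto
      also have "(\<lambda>x. \<lambda>i\<in>I. \<psi> i x) -` Pi\<^sub>E I A \<inter> space M = ?E"
        by (auto simp: PiE_iff)
      finally show ?thesis .
    qed
    moreover have "emeasure (?N i) (A i) = ennreal (prob (?S i))" if "i \<in> I" for i
      using that m[OF that] A[OF that] by (simp add: emeasure_distr emeasure_eq_measure)
    ultimately show "emeasure ?D (Pi\<^sub>E I A) = (\<Prod>i\<in>I. emeasure (?N i) (A i))"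
      by (simp add: emeasure_eq_measure prod_ennreal cong: prod.cong)
  qed
qed

end

section \<open>Log-concavity of ball probabilities\<close>

context gaussian_space
begin

text \<open>If \<open>cov (gram_schmidt \<phi> j) (gram_schmidt \<phi> j) = 0\<close> the coefficient is \<open>0\<close> by \<open>x / 0 = 0\<close>, which is
  the right value since then \<open>gram_schmidt \<phi> j\<close> vanishes almost everywhere.\<close>

function gram_schmidt :: "(nat \<Rightarrow> 'a \<Rightarrow> real) \<Rightarrow> nat \<Rightarrow> 'a \<Rightarrow> real" where
  "gram_schmidt \<phi> n = (\<lambda>x. \<phi> n x -
     (\<Sum>j<n. cov (\<phi> n) (gram_schmidt \<phi> j) / cov (gram_schmidt \<phi> j) (gram_schmidt \<phi> j) * gram_schmidt \<phi> j x))"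
  by auto
termination by (relation "inv_image less_than snd") auto

declare gram_schmidt.simps [simp del]

lemma bounded_linear_gram_schmidt:
  assumes "\<And>n. bounded_linear (\<phi> n)"
  shows "bounded_linear (gram_schmidt \<phi> n)"
proof (induction n rule: less_induct)
  case (less n)
  show ?case
    unfolding gram_schmidt.simps[of \<phi> n]
    by (intro bounded_linear_sub bounded_linear_sum bounded_linear_const_mult assms less) simp
qed

lemma gram_schmidt_uncorrelated:
  assumes "\<And>n. bounded_linear (\<phi> n)" "i \<noteq> j"
  shows "cov (gram_schmidt \<phi> i) (gram_schmidt \<phi> j) = 0"
proof -
  note bl = bounded_linear_gram_schmidt[of \<phi>, OF assms(1)]
  have "\<forall>k<n. cov (gram_schmidt \<phi> n) (gram_schmidt \<phi> k) = 0" for n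
  proof (induction n rule: less_induct)
    case (less n)
    show ?case
    proof (intro allI impI)
      fix k assume k: "k < n"
      let ?g = "gram_schmidt \<phi>"
      let ?c = "\<lambda>j. cov (\<phi> n) (?g j) / cov (?g j) (?g j)"
      have gs: "?g n = (\<lambda>x. \<phi> n x - (\<Sum>j<n. ?c j * ?g j x))" by (rule gram_schmidt.simps)
      have "cov (?g n) (?g k) = cov (\<phi> n) (?g k) - cov (\<lambda>x. \<Sum>j<n. ?c j * ?g j x) (?g k)"
        unfolding gs by (intro cov_diff_left assms(1) bl bounded_linear_sum bounded_linear_const_mult)
      also have "cov (\<lambda>x. \<Sum>j<n. ?c j * ?g j x) (?g k) = (\<Sum>j<n. cov (\<lambda>x. ?c j * ?g j x) (?g k))"
        by (intro cov_sum_left bl bounded_linear_const_mult)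
      also have "\<dots> = (\<Sum>j<n. ?c j * cov (?g j) (?g k))" by (simp only: cov_scale_left)
      also have "(\<Sum>j<n. ?c j * cov (?g j) (?g k)) = (\<Sum>j<n. if j = k then ?c k * cov (?g k) (?g k) else 0)"
      proof (intro sum.cong refl)
        fix j assume j: "j \<in> {..<n}"
        show "?c j * cov (?g j) (?g k) = (if j = k then ?c k * cov (?g k) (?g k) else 0)"
        proof (cases "j = k")
          case False
          \<comment> \<open>The induction hypothesis is indexed by the larger of the two indices, so
            \<open>j < k\<close> needs the symmetry of \<open>cov\<close>.\<close>
          then have "cov (?g j) (?g k) = 0"
            using less[of j] less[of k] j k cov_commute[of "?g j" "?g k"] by (cases "k < j") auto
          with False show ?thesis by simp
        qed simp
      qed
      also have "\<dots> = ?c k * cov (?g k) (?g k)" using k by simp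
      \<comment> \<open>For variance zero the left side is \<open>0\<close>, and the right side
        vanishes by \<open>cov_eq_0_of_self\<close>.\<close>
      also have "\<dots> = cov (\<phi> n) (?g k)"
        using cov_eq_0_of_self[OF assms(1)[of n] bl[of k]] by (cases "cov (?g k) (?g k) = 0") auto
      finally show "cov (?g n) (?g k) = 0" by simp
    qed
  qed
  then show ?thesis using assms(2) cov_commute by (metis linorder_neqE_nat)
qed

lemma log_concave_distr_bounded_linear:
  assumes "bounded_linear \<phi>"
  shows "log_concave_measure (distr M borel \<phi>) (\<lambda>x y. (x + y) / 2 :: real)"
  by (cases rule: bounded_linear_distr_cases[OF assms])
    (auto intro: log_concave_return log_concave_normal)

text \<open>The characteristic function depends only on the variance, which ignores the sign. This
  symmetry is the source of the equal masses of balls around \<open>a\<close> and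
  \<open>- a\<close>.\<close>

lemma distr_uminus_bounded_linear:
  assumes bl: "bounded_linear \<phi>"
  shows "distr M borel (\<lambda>x. - \<phi> x) = distr M borel (\<phi> :: 'a \<Rightarrow> real)"
proof (rule Levy_uniqueness)
  have bl': "bounded_linear (\<lambda>x. - \<phi> x)" using bl by (rule bounded_linear_minus)
  note [measurable] = borel_measurable_bounded_linear[OF bl]
  show "real_distribution (distr M borel (\<lambda>x. - \<phi> x))" "real_distribution (distr M borel \<phi>)"
    by (intro real_distribution.intro prob_space_distr real_distribution_axioms.intro; simp)+
  show "char (distr M borel (\<lambda>x. - \<phi> x)) = char (distr M borel \<phi>)"
  proof
    fix t
    have 1: "bounded_linear (\<lambda>x. t * - \<phi> x)" "bounded_linear (\<lambda>x. t * \<phi> x)"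
      by (rule bounded_linear_const_mult[OF bl'], rule bounded_linear_const_mult[OF bl])
    have "(\<integral>x. iexp (t * - \<phi> x) \<partial>M) = (\<integral>x. iexp (t * \<phi> x) \<partial>M)"
      unfolding char_bounded_linear[OF 1(1)] char_bounded_linear[OF 1(2)] by (simp add: cov_def)
    then show "char (distr M borel (\<lambda>x. - \<phi> x)) t = char (distr M borel \<phi>) t"
      unfolding char_def by (subst (1 2) integral_distr) auto
  qed
qed

end

section \<open>Closed balls as limits of slabs in uncorrelated coordinates\<close>

locale gaussian_norming = gaussian_space +
  fixes \<phi> :: "nat \<Rightarrow> 'a \<Rightarrow> real"
  assumes bl: "\<And>n. bounded_linear (\<phi> n)"
    and norming: "\<And>x t. norm x \<le> t \<longleftrightarrow> (\<forall>n. \<bar>\<phi> n x\<bar> \<le> t)"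
begin

text \<open>Cylinders over finitely many functionals; they decrease with \<open>N\<close> to the
  closed ball of radius \<open>s\<close> around \<open>a\<close>.\<close>

definition slab :: "nat \<Rightarrow> 'a \<Rightarrow> real \<Rightarrow> 'a set" where
  "slab N a s = {x. \<forall>n\<le>N. \<bar>\<phi> n x - \<phi> n a\<bar> \<le> s}"

definition coord :: "nat \<Rightarrow> 'a \<Rightarrow> nat \<Rightarrow> real" where
  "coord N x = (\<lambda>i\<in>{..N}. gram_schmidt \<phi> i x)"

definition coord_distr :: "nat \<Rightarrow> (nat \<Rightarrow> real) measure" where
  "coord_distr N = distr M (PiM {..N} (\<lambda>_. borel)) (coord N)"

text \<open>The inverse of the triangular Gram-Schmidt map. Being linear, it respects midpoints and
  reflections.\<close>

definition from_coord :: "nat \<Rightarrow> (nat \<Rightarrow> real) \<Rightarrow> real" where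
  "from_coord n u = u n + (\<Sum>j<n. cov (\<phi> n) (gram_schmidt \<phi> j) / cov (gram_schmidt \<phi> j) (gram_schmidt \<phi> j) * u j)"

definition coord_slab :: "nat \<Rightarrow> (nat \<Rightarrow> real) \<Rightarrow> real \<Rightarrow> (nat \<Rightarrow> real) set" where
  "coord_slab N \<alpha> s = {u \<in> space (PiM {..N} (\<lambda>_. borel)). \<forall>n\<le>N. \<bar>from_coord n u - \<alpha> n\<bar> \<le> s}"

lemma from_coord_coord:
  assumes "n \<le> N"
  shows "from_coord n (coord N x) = \<phi> n x"
proof -
  have "from_coord n (coord N x) = from_coord n (\<lambda>i. gram_schmidt \<phi> i x)"
    using assms by (auto simp: from_coord_def coord_def intro!: sum.cong)
  then show ?thesis by (simp add: from_coord_def) (subst gram_schmidt.simps, simp)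
qed

lemma from_coord_uminus: "from_coord n (\<lambda>i. - u i) = - from_coord n u"
  by (simp add: from_coord_def sum_negf)

lemma from_coord_midpoint: "from_coord n (\<lambda>i. (u i + v i) / 2) = (from_coord n u + from_coord n v) / 2"
  by (simp add: from_coord_def add_divide_distrib distrib_left sum.distrib sum_divide_distrib)

lemma from_coord_cong: "(\<And>i. i \<le> n \<Longrightarrow> u i = v i) \<Longrightarrow> from_coord n u = from_coord n v"
  by (auto simp: from_coord_def intro!: sum.cong)

lemma measurable_gram_schmidt: "gram_schmidt \<phi> i \<in> borel_measurable M"
  by (intro borel_measurable_bounded_linear bounded_linear_gram_schmidt bl)

lemma measurable_coord: "coord N \<in> measurable M (PiM {..N} (\<lambda>_. borel))"
  unfolding coord_def by (intro measurable_restrict measurable_gram_schmidt)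

lemma measurable_from_coord:
  assumes "n \<le> N"
  shows "from_coord n \<in> borel_measurable (PiM {..N} (\<lambda>_. borel))"
  unfolding from_coord_def using assms
  by (intro borel_measurable_add borel_measurable_sum borel_measurable_times borel_measurable_const
      measurable_component_singleton) auto

lemma sets_coord_slab: "coord_slab N \<alpha> s \<in> sets (PiM {..N} (\<lambda>_. borel))"
proof -
  have "coord_slab N \<alpha> s = (\<Inter>n\<in>{..N}. {u \<in> space (PiM {..N} (\<lambda>_. borel)). \<bar>from_coord n u - \<alpha> n\<bar> \<le> s})"
    by (auto simp: coord_slab_def)
  also have "\<dots> \<in> sets (PiM {..N} (\<lambda>_. borel))"
  proof (intro sets.finite_INT)
    fix n assume "n \<in> {..N}"
    then have [measurable]: "from_coord n \<in> borel_measurable (PiM {..N} (\<lambda>_. borel))"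
      by (intro measurable_from_coord) auto
    show "{u \<in> space (PiM {..N} (\<lambda>_. borel)). \<bar>from_coord n u - \<alpha> n\<bar> \<le> s} \<in> sets (PiM {..N} (\<lambda>_. borel))"
      by measurable
  qed auto
  finally show ?thesis .
qed

lemma vimage_coord_slab:
  "coord N -` coord_slab N (\<lambda>n. \<phi> n a) s \<inter> space M = slab N a s"
  using measurable_space[OF measurable_coord] by (auto simp: coord_slab_def slab_def from_coord_coord)

lemma sets_slab: "slab N a s \<in> sets M"
  using measurable_sets[OF measurable_coord sets_coord_slab] unfolding vimage_coord_slab[symmetric] .

lemma emeasure_coord_slab:
  "emeasure (coord_distr N) (coord_slab N (\<lambda>n. \<phi> n a) s) = prob (slab N a s)"
  unfolding coord_distr_def
  by (simp add: emeasure_distr measurable_coord sets_coord_slab vimage_coord_slab[simplified] emeasure_eq_measure)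

lemma coord_distr_eq_PiM:
  "coord_distr N = PiM {..N} (\<lambda>i. if i \<in> {..N} then distr M borel (gram_schmidt \<phi> i) else return borel 0)"
  unfolding coord_distr_def coord_def
  by (intro distr_uncorrelated_eq_PiM bounded_linear_gram_schmidt gram_schmidt_uncorrelated bl) auto

text \<open>Negated coordinates are again uncorrelated and have the same one-dimensional laws, hence
  the same product as joint law.\<close>

lemma coord_distr_uminus:
  "distr M (PiM {..N} (\<lambda>_. borel)) (\<lambda>x. \<lambda>i\<in>{..N}. - gram_schmidt \<phi> i x) = coord_distr N"
proof -
  note g = bounded_linear_gram_schmidt[of \<phi>, OF bl]
  have c: "cov (\<lambda>x. - \<psi> x) (\<lambda>x. - \<psi>' x) = cov \<psi> \<psi>'" for \<psi> \<psi>' by (simp add: cov_def)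
  have "distr M (PiM {..N} (\<lambda>_. borel)) (\<lambda>x. \<lambda>i\<in>{..N}. (\<lambda>i x. - gram_schmidt \<phi> i x) i x)
      = PiM {..N} (\<lambda>i. if i \<in> {..N} then distr M borel (\<lambda>x. - gram_schmidt \<phi> i x) else return borel 0)"
    by (rule distr_uncorrelated_eq_PiM) (auto simp: c g bounded_linear_minus gram_schmidt_uncorrelated bl)
  then show ?thesis unfolding coord_distr_eq_PiM distr_uminus_bounded_linear[OF g] by simp
qed

lemma prob_slab_uminus: "prob (slab N (- a) s) = prob (slab N a s)"
proof -
  let ?c = "\<lambda>x. \<lambda>i\<in>{..N}. - gram_schmidt \<phi> i x"
  have m: "?c \<in> measurable M (PiM {..N} (\<lambda>_. borel))"
    by (intro measurable_restrict borel_measurable_uminus measurable_gram_schmidt)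
  have "from_coord n (?c x) = - \<phi> n x" if "n \<le> N" for n x
  proof -
    have "from_coord n (?c x) = from_coord n (\<lambda>i. - coord N x i)"
      using that by (intro from_coord_cong) (auto simp: coord_def)
    then show ?thesis using that by (simp add: from_coord_uminus from_coord_coord)
  qed
  then have "?c -` coord_slab N (\<lambda>n. \<phi> n a) s \<inter> space M = slab N (- a) s"
    using measurable_space[OF m] linear_neg[OF bounded_linear.linear[OF bl]]
    by (auto simp: coord_slab_def slab_def abs_minus_commute add.commute)
  then have "emeasure (coord_distr N) (coord_slab N (\<lambda>n. \<phi> n a) s) = prob (slab N (- a) s)"
    unfolding coord_distr_uminus[symmetric]
    by (simp add: emeasure_distr m sets_coord_slab emeasure_eq_measure)
  then show ?thesis unfolding emeasure_coord_slab by simp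
qed

text \<open>The integral inequality is applied to indicators in the coordinates whose law is a
  product. Since \<open>from_coord\<close> is linear, midpoints of points from two coordinate slabs
  lie in the slab with averaged centre and radius.\<close>

lemma prob_slab_midpoint:
  "prob (slab N a s) * prob (slab N b t) \<le> (prob (slab N ((1/2) *\<^sub>R (a + b)) ((s + t) / 2)))\<^sup>2"
proof -
  let ?S = "\<lambda>a s. coord_slab N (\<lambda>n. \<phi> n a) s"
  let ?D = "coord_distr N"
  have "log_concave_measure ?D (\<lambda>x y i. (x i + y i) / 2)"
    unfolding coord_distr_eq_PiM
  proof (rule log_concave_PiM)
    fix i
    show "prob_space (if i \<in> {..N} then distr M borel (gram_schmidt \<phi> i) else return borel 0)"
      using measurable_gram_schmidt by (auto intro: prob_space_distr prob_space_return)
    show "log_concave_measure (if i \<in> {..N} then distr M borel (gram_schmidt \<phi> i) else return borel 0) (\<lambda>x y. (x + y) / 2)"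
      by (auto intro!: log_concave_distr_bounded_linear bounded_linear_gram_schmidt bl log_concave_return)
  qed auto
  moreover have S: "?S a s \<in> sets ?D" for a s by (simp add: coord_distr_def sets_coord_slab)
  ultimately have "(\<integral>\<^sup>+u. indicator (?S a s) u \<partial>?D) * (\<integral>\<^sup>+u. indicator (?S b t) u \<partial>?D)
      \<le> (\<integral>\<^sup>+u. indicator (?S ((1/2) *\<^sub>R (a + b)) ((s + t) / 2)) u \<partial>?D)\<^sup>2"
  proof (intro log_concave_measureD[where C = 1] borel_measurable_indicator)
    fix u v assume uv: "u \<in> space ?D" "v \<in> space ?D"
    show "indicator (?S a s) u * indicator (?S b t) v
      \<le> (indicator (?S ((1/2) *\<^sub>R (a + b)) ((s + t) / 2)) (\<lambda>i. (u i + v i) / 2) :: ennreal)\<^sup>2"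
    proof (cases "u \<in> ?S a s \<and> v \<in> ?S b t")
      case True
      have "\<bar>(from_coord n u + from_coord n v) / 2 - \<phi> n ((1/2) *\<^sub>R (a + b))\<bar> \<le> (s + t) / 2" if "n \<le> N" for n
      proof -
        have "\<bar>from_coord n u - \<phi> n a\<bar> \<le> s" "\<bar>from_coord n v - \<phi> n b\<bar> \<le> t"
          using True that by (auto simp: coord_slab_def)
        moreover have "\<phi> n ((1/2) *\<^sub>R (a + b)) = (\<phi> n a + \<phi> n b) / 2"
          using linear_add[OF bounded_linear.linear[OF bl]] linear_scale[OF bounded_linear.linear[OF bl]] by simp
        ultimately show ?thesis by (simp add: abs_le_iff field_simps)
      qed
      moreover have "(\<lambda>i. (u i + v i) / 2) \<in> space (PiM {..N} (\<lambda>_. borel))"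
        using uv by (auto simp: coord_distr_def space_PiM PiE_def extensional_def)
      ultimately have "(\<lambda>i. (u i + v i) / 2) \<in> ?S ((1/2) *\<^sub>R (a + b)) ((s + t) / 2)"
        by (auto simp: coord_slab_def from_coord_midpoint)
      then show ?thesis by (simp add: indicator_def)
    qed (auto simp: indicator_def)
  qed (auto simp: S split: split_indicator)
  then have "ennreal (prob (slab N a s)) * ennreal (prob (slab N b t))
      \<le> (ennreal (prob (slab N ((1/2) *\<^sub>R (a + b)) ((s + t) / 2))))\<^sup>2"
    by (simp add: S emeasure_coord_slab)
  then show ?thesis
    by (simp add: ennreal_power flip: ennreal_mult)
qed

lemma prob_slab_tendsto: "(\<lambda>N. prob (slab N a s)) \<longlonglongrightarrow> prob (cball a s)"
proof -
  have "x \<in> (\<Inter>N. slab N a s) \<longleftrightarrow> x \<in> cball a s" for x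
  proof -
    have "x \<in> (\<Inter>N. slab N a s) \<longleftrightarrow> (\<forall>n. \<bar>\<phi> n (x - a)\<bar> \<le> s)"
      unfolding linear_diff[OF bounded_linear.linear[OF bl]] by (auto simp: slab_def)
    also have "\<dots> \<longleftrightarrow> norm (x - a) \<le> s" by (rule norming[symmetric])
    also have "\<dots> \<longleftrightarrow> x \<in> cball a s" by (metis dist_commute dist_norm mem_cball)
    finally show ?thesis .
  qed
  then have "(\<Inter>N. slab N a s) = cball a s" by (intro set_eqI)
  moreover have "(\<lambda>N. prob (slab N a s)) \<longlonglongrightarrow> prob (\<Inter>N. slab N a s)"
  proof (rule finite_Lim_measure_decseq)
    show "decseq (\<lambda>N. slab N a s)"
      unfolding decseq_def slab_def by (blast intro: order_trans)
  qed (use sets_slab in blast)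
  ultimately show ?thesis by simp
qed

lemma prob_cball_uminus': "prob (cball (- a) s) = prob (cball a s)"
  using prob_slab_tendsto[of "- a" s] prob_slab_tendsto[of a s]
  unfolding prob_slab_uminus by (rule LIMSEQ_unique)

lemma prob_cball_midpoint':
  "prob (cball a s) * prob (cball b t) \<le> (prob (cball ((1/2) *\<^sub>R (a + b)) ((s + t) / 2)))\<^sup>2"
  using prob_slab_midpoint
  by (intro LIMSEQ_le[OF tendsto_mult[OF prob_slab_tendsto prob_slab_tendsto] tendsto_power[OF prob_slab_tendsto]]) blast

end

context gaussian_space
begin

lemma prob_cball_uminus: "prob (cball (- a) s) = prob (cball a s)"
  and prob_cball_midpoint:
    "prob (cball a s) * prob (cball b t) \<le> (prob (cball ((1/2) *\<^sub>R (a + b)) ((s + t) / 2)))\<^sup>2"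
proof -
  obtain \<phi> :: "nat \<Rightarrow> 'a \<Rightarrow> real" where \<phi>: "\<And>n. bounded_linear (\<phi> n)"
    "\<And>x t. norm x \<le> t \<longleftrightarrow> (\<forall>n. \<bar>\<phi> n x\<bar> \<le> t)"
    by (rule exists_norming_sequence) (rule that)
  interpret gaussian_norming M \<phi>
    using \<phi> by (simp add: gaussian_norming_def gaussian_norming_axioms_def gaussian_space_axioms)
  show "prob (cball (- a) s) = prob (cball a s)" by (rule prob_cball_uminus')
  show "prob (cball a s) * prob (cball b t) \<le> (prob (cball ((1/2) *\<^sub>R (a + b)) ((s + t) / 2)))\<^sup>2"
    by (rule prob_cball_midpoint')
qed

lemma anderson_cball: "prob (cball a s) \<le> prob (cball 0 s)"
proof -
  have "(prob (cball a s))\<^sup>2 \<le> (prob (cball 0 s))\<^sup>2"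
    using prob_cball_midpoint[of a s "- a" s] by (simp add: prob_cball_uminus power2_eq_square)
  then show ?thesis by (rule power2_le_imp_le) simp
qed

end

section \<open>Distortion and small balls\<close>

context gaussian_space
begin

lemma prob_cball_mono: "s \<le> t \<Longrightarrow> prob (cball a s) \<le> prob (cball a t)"
  by (intro finite_measure_mono) auto

lemma prob_cball_right_continuous:
  "(\<lambda>n. prob (cball a (s + inverse (real (Suc n))))) \<longlonglongrightarrow> prob (cball a s)"
proof -
  let ?s = "\<lambda>n. s + inverse (real (Suc n))"
  have lim: "?s \<longlonglongrightarrow> s"
    using tendsto_add[OF tendsto_const LIMSEQ_inverse_real_of_nat, of s] by simp
  have dec: "?s n \<le> ?s m" if "m \<le> n" for m n
    using that by (simp add: inverse_le_iff_le)
  have ge: "s \<le> ?s n" for n by simp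
  have "x \<in> (\<Inter>n. cball a (?s n)) \<longleftrightarrow> x \<in> cball a s" for x
  proof
    assume "x \<in> (\<Inter>n. cball a (?s n))"
    then have "\<forall>n. dist a x \<le> ?s n" by simp
    with lim have "dist a x \<le> s" by (intro LIMSEQ_le_const) blast+
    then show "x \<in> cball a s" by simp
  next
    assume "x \<in> cball a s"
    then have "x \<in> cball a (?s n)" for n using subset_cball[OF ge] by blast
    then show "x \<in> (\<Inter>n. cball a (?s n))" by blast
  qed
  then have "(\<Inter>n. cball a (?s n)) = cball a s" by (intro set_eqI)
  moreover have "(\<lambda>n. prob (cball a (?s n))) \<longlonglongrightarrow> prob (\<Inter>n. cball a (?s n))"
  proof (rule finite_Lim_measure_decseq)
    show "decseq (\<lambda>n. cball a (?s n))"
      unfolding decseq_def by (intro allI impI subset_cball dec)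
    show "range (\<lambda>n. cball a (?s n)) \<subseteq> events" by (intro image_subsetI) simp
  qed
  ultimately show ?thesis by simp
qed

text \<open>The mass cannot jump at a radius \<open>s > 0\<close>: letting \<open>t\<close> increase
  to \<open>s\<close> in the midpoint inequality, the left limit times the mass at \<open>s\<close>
  is at most the square of the left limit, which is positive. A jump at radius zero would be a point
  mass at the origin.\<close>

lemma exists_cball_prob_eq:
  assumes pos: "\<And>s. s > 0 \<Longrightarrow> prob (cball 0 s) > 0"
    and "prob {0} = 0" "0 < y" "y \<le> prob (cball 0 1)"
  obtains s where "s > 0" "prob (cball 0 s) = y"
proof -
  let ?F = "\<lambda>s. prob (cball (0 :: 'a) s)"
  define T where "T = {t. 0 \<le> t \<and> y \<le> ?F t}"
  define s where "s = Inf T"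
  have "1 \<in> T" using assms by (simp add: T_def)
  have bdd: "bdd_below T" by (auto simp: T_def intro: bdd_belowI)
  have s0: "0 \<le> s" unfolding s_def
  proof (rule cInf_greatest)
    show "T \<noteq> {}" using \<open>1 \<in> T\<close> by blast
  qed (simp add: T_def)
  have below: "?F t < y" if "0 \<le> t" "t < s" for t
  proof (rule ccontr)
    assume "\<not> ?F t < y"
    with that have "t \<in> T" by (simp add: T_def)
    then have "s \<le> t" unfolding s_def by (rule cInf_lower[OF _ bdd])
    with that show False by simp
  qed
  have above: "y \<le> ?F t" if "s < t" for t
  proof -
    have "T \<noteq> {}" using \<open>1 \<in> T\<close> by blast
    then have "\<exists>u\<in>T. u < t" by (rule cInf_lessD) (use that in \<open>simp add: s_def\<close>)
    then obtain u where "u \<in> T" "u < t" by blast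
    then show ?thesis using prob_cball_mono[of u t 0] by (simp add: T_def)
  qed
  have "y \<le> ?F s"
  proof (rule LIMSEQ_le_const)
    show "(\<lambda>n. ?F (s + inverse (real (Suc n)))) \<longlonglongrightarrow> ?F s"
      by (rule prob_cball_right_continuous)
    have "y \<le> ?F (s + inverse (real (Suc n)))" for n by (intro above) simp
    then show "\<exists>N. \<forall>n\<ge>N. y \<le> ?F (s + inverse (real (Suc n)))" by blast
  qed
  \<comment> \<open>Radius \<open>0\<close> would give \<open>y \<le> prob {0} = 0\<close>.\<close>
  moreover from this have "s > 0" using assms(2,3) s0 by (cases "s = 0") auto
  have "?F s \<le> y"
  proof -
    define L where "L = (SUP t\<in>{0..<s}. ?F t)"
    have bdd': "bdd_above (?F ` {0..<s})" by (rule bdd_aboveI2[where M = 1]) simp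
    have FL: "?F t \<le> L" if "0 \<le> t" "t < s" for t
      unfolding L_def using bdd' that by (intro cSUP_upper) auto
    \<comment> \<open>The midpoint of \<open>t\<close> and \<open>s\<close> is still below
      \<open>s\<close>, so one factor is bounded by \<open>y\<close> and the other by the left limit
      \<open>L\<close>.\<close>
    have le: "?F t * ?F s \<le> y * L" if t: "0 \<le> t" "t < s" for t
    proof -
      let ?m = "(t + s) / 2"
      have "?F t * ?F s \<le> ?F ?m * ?F ?m"
        using prob_cball_midpoint[of 0 t 0 s] by (simp add: power2_eq_square)
      also have "\<dots> \<le> y * L"
        using t below[of ?m] FL[of ?m] assms by (intro mult_mono) auto
      finally show ?thesis .
    qed
    show ?thesis
    proof (rule ccontr)
      assume "\<not> ?thesis"
      then have less: "y < ?F s" by simp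
      have Fs: "?F s > 0" using pos \<open>s > 0\<close> .
      have "(SUP t\<in>{0..<s}. ?F t) \<le> y * L / ?F s"
      proof (rule cSUP_least)
        show "?F t \<le> y * L / ?F s" if "t \<in> {0..<s}" for t
          using le[of t] that Fs by (simp add: pos_le_divide_eq)
      qed (use \<open>s > 0\<close> in simp)
      then have "L \<le> y * L / ?F s" unfolding L_def .
      then have "L * ?F s \<le> L * y" using Fs by (simp add: pos_le_divide_eq mult.commute)
      moreover have "0 < L" using FL[of "s / 2"] pos[of "s / 2"] \<open>s > 0\<close> by auto
      ultimately show False using less by simp
    qed
  qed
  ultimately have "?F s = y" by linarith
  with \<open>s > 0\<close> show ?thesis by (rule that)
qed

lemma optimal_distortion_le:
  assumes r: "r > 0" and s: "s > 0" and ps: "prob (cball 0 s) = exp (- R)"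
  shows "optimal_distortion M r R \<le> ennreal (s powr r * exp (- R))"
proof (rule ennreal_le_epsilon)
  fix e :: real assume e: "e > 0"
  \<comment> \<open>With this mesh the fine cells contribute at most \<open>e\<close>, as
    \<open>M\<close> has mass one.\<close>
  define \<epsilon> where "\<epsilon> = e powr (1 / r)"
  have \<epsilon>: "\<epsilon> > 0" "\<epsilon> powr r = e" using e r by (auto simp: \<epsilon>_def powr_powr)
  obtain D :: "'a set" where D: "countable D" "\<And>X. open X \<Longrightarrow> X \<noteq> {} \<Longrightarrow> \<exists>d\<in>D. d \<in> X"
    using countable_dense_setE by metis
  have "D \<noteq> {}" using D(2)[of UNIV] by auto
  define d where "d = from_nat_into D"
  \<comment> \<open>Taking the least index makes the choice of a nearby dense point
    measurable.\<close>
  define k where "k x = (LEAST n. dist x (d n) < \<epsilon>)" for x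
  define f where "f x = (if norm x \<le> s then 0 else d (k x))" for x
  have dk: "dist x (d (k x)) < \<epsilon>" for x
  proof -
    obtain y where "y \<in> D" "y \<in> ball x \<epsilon>" using D(2)[of "ball x \<epsilon>"] \<epsilon> by auto
    then obtain n where "dist x (d n) < \<epsilon>"
      using from_nat_into_surj[OF D(1)] by (metis d_def mem_ball)
    then show ?thesis unfolding k_def by (rule LeastI)
  qed
  have [measurable]: "k \<in> measurable borel (count_space UNIV)"
    unfolding k_def by measurable
  have fm[measurable]: "f \<in> borel_measurable borel"
    unfolding f_def by measurable
  have "range f \<subseteq> insert 0 (range d)" by (auto simp: f_def)
  then have "countable (range f)" by (rule countable_subset) auto
  with fm have fq: "f \<in> quantizers" by (simp add: quantizers_def)
  have "renyi_infty_entropy M f \<le> R"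
  proof -
    have "f 0 = 0" using s by (simp add: f_def)
    then have r0: "0 \<in> range f" by (metis rangeI)
    \<comment> \<open>Only an inequality, since \<open>0\<close> may also occur among the dense
      points; a heavier cell lowers the entropy, which is the favourable direction.\<close>
    have "exp (- R) \<le> prob (f -` {0})"
      unfolding ps[symmetric]
    proof (rule finite_measure_mono)
      show "f -` {0} \<in> events" using measurable_sets[OF fm, of "{0}"] by simp
    qed (auto simp: f_def)
    also have "\<dots> \<le> (SUP z\<in>range f. prob (f -` {z}))"
      using r0 by (intro cSUP_upper bdd_aboveI2[where M = 1]) auto
    finally have "ln (exp (- R)) \<le> ln (SUP z\<in>range f. prob (f -` {z}))"
      by (subst ln_le_cancel_iff) (auto intro: less_le_trans[OF exp_gt_zero])
    then show ?thesis by (simp add: renyi_infty_entropy_def)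
  qed
  with fq have "optimal_distortion M r R \<le> distortion M r f"
    unfolding optimal_distortion_def by (intro INF_lower) auto
  also have "\<dots> \<le> (\<integral>\<^sup>+x. ennreal (s powr r) * indicator (cball 0 s) x + ennreal e \<partial>M)"
    unfolding distortion_def
  proof (rule nn_integral_mono)
    fix x
    show "ennreal (norm (x - f x) powr r) \<le> ennreal (s powr r) * indicator (cball 0 s) x + ennreal e"
    proof (cases "norm x \<le> s")
      case True
      then have "norm (x - f x) powr r \<le> s powr r" using r by (auto simp: f_def intro: powr_mono2)
      with True show ?thesis
        by (auto intro!: order_trans[OF ennreal_leI] simp: add_increasing2)
    next
      case False
      then have "norm (x - f x) powr r \<le> \<epsilon> powr r"
        using dk[of x] r by (intro powr_mono2) (auto simp: f_def dist_norm)
      with False show ?thesis using \<epsilon> by (auto intro: ennreal_leI)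
    qed
  qed
  also have "\<dots> = (\<integral>\<^sup>+x. ennreal (s powr r) * indicator (cball 0 s) x \<partial>M) + (\<integral>\<^sup>+x. ennreal e \<partial>M)"
    by (intro nn_integral_add borel_measurable_times_ennreal borel_measurable_const borel_measurable_indicator) simp
  also have "(\<integral>\<^sup>+x. ennreal (s powr r) * indicator (cball 0 s) x \<partial>M) = ennreal (s powr r) * emeasure M (cball 0 s)"
    by (rule nn_integral_cmult_indicator) simp
  also have "emeasure M (cball 0 s) = ennreal (exp (- R))"
    unfolding emeasure_eq_measure ps ..
  also have "(\<integral>\<^sup>+x. ennreal e \<partial>M) = ennreal e"
    using emeasure_space_1 by simp
  also have "ennreal (s powr r) * ennreal (exp (- R)) = ennreal (s powr r * exp (- R))"
    by (rule ennreal_mult[symmetric]) auto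
  finally show "optimal_distortion M r R \<le> ennreal (s powr r * exp (- R)) + ennreal e" .
qed

text \<open>The radius \<open>t\<close> stays free. If the ball of radius \<open>t\<close> is
  heavier than \<open>exp (- R)\<close>, the bound is trivial because \<open>ennreal\<close> sends
  negative numbers to \<open>0\<close>.\<close>

lemma optimal_distortion_ge:
  assumes r: "r > 0" and t: "t \<ge> 0"
  shows "ennreal (t powr r * (exp (- R) - prob (cball 0 t))) \<le> optimal_distortion M r R"
  unfolding optimal_distortion_def
proof (rule INF_greatest)
  fix f assume "f \<in> {f \<in> quantizers. renyi_infty_entropy M f \<le> R}"
  then have f: "f \<in> quantizers" and H: "renyi_infty_entropy M f \<le> R" by auto
  \<comment> \<open>The supremum in the entropy is attained with positive mass, so the bound
    \<open>R\<close> yields an actual cell of mass at least \<open>exp (- R)\<close>.\<close>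
  obtain z where z: "prob (f -` {z}) = (SUP z\<in>range f. prob (f -` {z}))" "prob (f -` {z}) > 0"
    using quantizer_max_attained[OF prob_space_axioms sets_eq_borel f] by auto
  let ?A = "f -` {z}"
  have "exp (- R) \<le> exp (ln (prob ?A))"
    using H unfolding renyi_infty_entropy_def z(1)[symmetric] by simp
  then have p: "exp (- R) \<le> prob ?A" using z(2) by simp
  have fm: "f \<in> borel_measurable borel" using f by (simp add: quantizers_def)
  have A: "?A \<in> sets M" using measurable_sets[OF fm, of "{z}"] by simp
  have B: "cball z t \<in> sets M" by simp
  have AB: "?A - cball z t \<in> sets M" by (rule sets.Diff[OF A B])
  have "prob ?A \<le> prob (?A - cball z t) + prob (cball z t)"
  proof -
    have "prob ?A \<le> prob ((?A - cball z t) \<union> cball z t)" by (intro finite_measure_mono sets.Un AB B) blast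
    also have "\<dots> \<le> prob (?A - cball z t) + prob (cball z t)" by (intro measure_Un_le AB B)
    finally show ?thesis .
  qed
  with p anderson_cball[of z t] have q: "exp (- R) - prob (cball 0 t) \<le> prob (?A - cball z t)" by simp
  have "ennreal (t powr r * (exp (- R) - prob (cball 0 t))) \<le> ennreal (t powr r * prob (?A - cball z t))"
    using q by (intro ennreal_leI mult_left_mono) auto
  also have "\<dots> = ennreal (t powr r) * emeasure M (?A - cball z t)"
    unfolding emeasure_eq_measure by (rule ennreal_mult) auto
  also have "\<dots> = (\<integral>\<^sup>+x. ennreal (t powr r) * indicator (?A - cball z t) x \<partial>M)"
    by (rule nn_integral_cmult_indicator[OF AB, symmetric])
  also have "\<dots> \<le> distortion M r f"
    unfolding distortion_def
  proof (rule nn_integral_mono)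
    fix x
    show "ennreal (t powr r) * indicator (?A - cball z t) x \<le> ennreal (norm (x - f x) powr r)"
    proof (cases "x \<in> ?A - cball z t")
      case True
      then have "t powr r \<le> norm (x - f x) powr r"
        using r t by (intro powr_mono2) (auto simp: dist_norm norm_minus_commute)
      with True show ?thesis by (simp add: ennreal_leI)
    qed simp
  qed
  finally show "ennreal (t powr r * (exp (- R) - prob (cball 0 t))) \<le> distortion M r f" .
qed

lemma enn2real_optimal_distortion_bounds:
  assumes r: "r > 0" and s: "s > 0" and ps: "prob (cball 0 s) = exp (- R)"
  shows "enn2real (optimal_distortion M r R) \<le> s powr r * exp (- R)"
    and "\<eta> > 0 \<Longrightarrow> (\<eta> * s) powr r * (exp (- R) - prob (cball 0 (\<eta> * s))) \<le> enn2real (optimal_distortion M r R)"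
proof -
  note le = optimal_distortion_le[OF assms]
  show "enn2real (optimal_distortion M r R) \<le> s powr r * exp (- R)"
    using enn2real_mono[OF le] by simp
  \<comment> \<open>An infinite value would be sent to \<open>0\<close> by \<open>enn2real\<close>
    and spoil the lower bound; the upper bound excludes it.\<close>
  have "optimal_distortion M r R < \<top>" using le by (rule le_less_trans) simp
  moreover assume "\<eta> > 0"
  ultimately show "(\<eta> * s) powr r * (exp (- R) - prob (cball 0 (\<eta> * s))) \<le> enn2real (optimal_distortion M r R)"
    using optimal_distortion_ge[OF r, of "\<eta> * s" R] s
    by (cases "optimal_distortion M r R") (auto simp: ennreal_le_iff)
qed

section \<open>The inverse of the small ball function\<close>

lemma prob_open_pos:
  assumes "measure_support M = UNIV" "open U" "x \<in> U"
  shows "prob U > 0"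
proof -
  have "x \<in> measure_support M" using assms(1) by simp
  then have "emeasure M U > 0" using assms by (auto simp: measure_support_def)
  then show ?thesis by (simp add: emeasure_eq_measure)
qed

text \<open>Full support charges the open annulus between the two radii, which contains the multiple
  of \<open>v\<close> of norm \<open>(s + t) / 2\<close>. Strictness makes
  \<open>small_ball M\<close> injective on the positive radii.\<close>

lemma prob_cball_strict_mono:
  assumes supp: "measure_support M = UNIV" and v: "(v :: 'a) \<noteq> 0" and st: "0 \<le> s" "s < t"
  shows "prob (cball 0 s) < prob (cball 0 t)"
proof -
  let ?U = "ball 0 t - cball (0 :: 'a) s"
  have "prob ?U > 0"
  proof (rule prob_open_pos[OF supp])
    show "(((s + t) / 2) / norm v) *\<^sub>R v \<in> ?U" using v st by auto
  qed auto
  then have "prob (cball 0 s) < prob (cball 0 s) + prob ?U" by simp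
  also have "\<dots> = prob (cball 0 s \<union> ?U)" by (intro finite_measure_Union[symmetric]) auto
  also have "\<dots> \<le> prob (cball 0 t)" using st by (intro finite_measure_mono) auto
  finally show ?thesis .
qed

lemma nonatomic_prob_singleton:
  assumes "nonatomic M"
  shows "prob {x} = 0"
proof (rule ccontr)
  assume "prob {x} \<noteq> 0"
  then have "emeasure M {x} > 0" by (simp add: emeasure_eq_measure zero_less_measure_iff)
  then have "atom_of M {x}"
    unfolding atom_of_def by (auto simp: subset_singleton_iff)
  with assms show False by (auto simp: nonatomic_def)
qed

lemma prob_cball_pos:
  assumes supp: "measure_support M = UNIV" and s: "s > 0"
  shows "prob (cball x s) > 0"
  using prob_open_pos[OF supp, of "ball x s" x] finite_measure_mono[of "ball x s" "cball x s"] s by auto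

text \<open>By injectivity, any radius of the right mass is the value of the inverse; for large
  \<open>R\<close> such a radius comes from \<open>exists_cball_prob_eq\<close>.\<close>

lemma small_ball_inv_eq:
  assumes supp: "measure_support M = UNIV" and v: "(v :: 'a) \<noteq> 0"
    and s: "s > 0" "prob (cball 0 s) = exp (- R)"
  shows "small_ball_inv M R = s"
  unfolding small_ball_inv_def
proof (rule the_inv_into_f_eq)
  show "inj_on (small_ball M) {0<..}"
  proof (rule linorder_inj_onI')
    fix s t :: real assume "s \<in> {0<..}" "t \<in> {0<..}" "s < t"
    then have "prob (cball 0 s) < prob (cball 0 t)" "prob (cball 0 s) > 0" "prob (cball 0 t) > 0"
      using prob_cball_strict_mono[OF supp v, of s t] prob_cball_pos[OF supp] by auto
    then show "small_ball M s \<noteq> small_ball M t" by (auto simp: small_ball_def)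
  qed
  show "small_ball M s = R" using s by (simp add: small_ball_def)
qed (use s in simp)

text \<open>Once \<open>exp (- R)\<close> is below the mass of the unit ball, a radius of that mass
  exists. Comparison with the mass of a smaller ball forces this radius to tend to
  \<open>0\<close>.\<close>

lemma small_ball_inv_eventually:
  assumes na: "nonatomic M" and supp: "measure_support M = UNIV" and v: "(v :: 'a) \<noteq> 0"
  shows "\<forall>\<^sub>F R in at_top. small_ball_inv M R > 0 \<and> prob (cball 0 (small_ball_inv M R)) = exp (- R)"
    and "filterlim (small_ball_inv M) (at_right 0) at_top"
proof -
  have small: "\<forall>\<^sub>F R in at_top. exp (- R) < prob (cball 0 e)" if "e > 0" for e
  proof -
    have "((\<lambda>R :: real. exp (- R)) \<longlongrightarrow> 0) at_top"
      by (rule filterlim_compose[OF exp_at_bot filterlim_uminus_at_bot_at_top])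
    moreover have "prob (cball 0 e) > 0"
      using that by (rule prob_cball_pos[OF supp])
    ultimately show ?thesis by (rule order_tendstoD(2))
  qed
  show ev: "\<forall>\<^sub>F R in at_top. small_ball_inv M R > 0 \<and> prob (cball 0 (small_ball_inv M R)) = exp (- R)"
    using small[OF zero_less_one]
  proof eventually_elim
    case (elim R)
    then obtain s where "s > 0" "prob (cball 0 s) = exp (- R)"
      using exists_cball_prob_eq[OF prob_cball_pos[OF supp] nonatomic_prob_singleton[OF na], of "exp (- R)"] by auto
    then show ?case using small_ball_inv_eq[OF supp v] by simp
  qed
  show "filterlim (small_ball_inv M) (at_right 0) at_top"
  proof (rule tendsto_imp_filterlim_at_right)
    show "(small_ball_inv M \<longlongrightarrow> 0) at_top"
    proof (rule order_tendstoI)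
      fix e :: real assume "0 < e"
      show "\<forall>\<^sub>F R in at_top. small_ball_inv M R < e"
        using small[OF \<open>0 < e\<close>] ev
      proof eventually_elim
        case (elim R)
        then show ?case using prob_cball_mono[of e "small_ball_inv M R" 0] by (auto simp: not_le[symmetric])
      qed
    next
      fix a :: real assume "a < 0"
      then show "\<forall>\<^sub>F R in at_top. a < small_ball_inv M R" using ev by (auto elim!: eventually_mono)
    qed
    show "\<forall>\<^sub>F R in at_top. small_ball_inv M R > 0" using ev by (auto elim!: eventually_mono)
  qed
qed

end

theorem proposition3p10:
  fixes M :: "'a::{banach, second_countable_topology} measure" and r :: real
  assumes "\<nexists>B :: 'a set. finite B \<and> span B = UNIV"
    and "centered_gaussian_measure M"
    and "nonatomic M"
    and "measure_support M = UNIV"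
    and "r > 0"
    and "\<And>\<eta> :: real. 0 < \<eta> \<Longrightarrow> \<eta> < 1 \<Longrightarrow>
           ((\<lambda>s. measure M (cball 0 (\<eta> * s)) / measure M (cball 0 s)) \<longlongrightarrow> 0) (at_right 0)"
  shows "(\<lambda>R. enn2real (optimal_distortion M r R))
           \<sim>[at_top] (\<lambda>R. small_ball_inv M R powr r * exp (- R))"
proof -
  interpret gaussian_space M by (rule gaussian_space.intro) fact
  let ?D = "\<lambda>R. enn2real (optimal_distortion M r R)" and ?b = "small_ball_inv M"
  let ?F = "\<lambda>s. measure M (cball 0 s)"
  \<comment> \<open>A trivial space would be spanned by the empty set.\<close>
  obtain v :: 'a where v: "v \<noteq> 0"
    using assms(1) span_empty by (metis UNIV_eq_I finite.emptyI insertI1)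
  note ev = small_ball_inv_eventually(1)[OF assms(3,4) v]
    and lim = small_ball_inv_eventually(2)[OF assms(3,4) v]
  show ?thesis
  proof (rule asymp_equivI', rule order_tendstoI)
    fix a :: real assume "a < 1"
    \<comment> \<open>\<open>c\<close> lies strictly between \<open>a\<close> and \<open>1\<close>
      and is positive even for negative \<open>a\<close>, so it is \<open>\<eta> powr r\<close> for
      some \<open>\<eta>\<close> below \<open>1\<close>; it is the factor by which the lower bound
      falls short.\<close>
    define c where "c = (max a 0 + 1) / 2"
    have c: "a < c" "0 < c" "c < 1" using \<open>a < 1\<close> by (auto simp: c_def max_def)
    define \<eta> where "\<eta> = c powr (1 / r)"
    have \<eta>: "0 < \<eta>" "\<eta> < 1" "\<eta> powr r = c"
      using c assms(5) powr_less_mono2[of "1 / r" c 1] by (auto simp: \<eta>_def powr_powr)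
    have "((\<lambda>R. ?F (\<eta> * ?b R) / ?F (?b R)) \<longlongrightarrow> 0) at_top"
      by (rule filterlim_compose[OF assms(6)[OF \<eta>(1,2)] lim])
    then have "((\<lambda>R. c * (1 - ?F (\<eta> * ?b R) / ?F (?b R))) \<longlongrightarrow> c * (1 - 0)) at_top"
      by (intro tendsto_intros)
    then have "\<forall>\<^sub>F R in at_top. a < c * (1 - ?F (\<eta> * ?b R) / ?F (?b R))"
      using c by (intro order_tendstoD) auto
    then show "\<forall>\<^sub>F R in at_top. a < ?D R / (?b R powr r * exp (- R))"
      using ev
    proof eventually_elim
      case (elim R)
      \<comment> \<open>At the radius \<open>?b R\<close> the denominator of the hypothesis is
        exactly \<open>exp (- R)\<close>, which writes the lower bound as a factor tending to
        \<open>c\<close> times the claimed asymptotics.\<close>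
      have "c * (1 - ?F (\<eta> * ?b R) / exp (- R)) * (?b R powr r * exp (- R))
          = (\<eta> * ?b R) powr r * (exp (- R) - ?F (\<eta> * ?b R))"
        using elim \<eta> by (simp add: powr_mult right_diff_distrib) (simp add: field_simps)
      also have "\<dots> \<le> ?D R"
        using elim \<eta> assms(5) by (intro enn2real_optimal_distortion_bounds) auto
      finally have "c * (1 - ?F (\<eta> * ?b R) / exp (- R)) \<le> ?D R / (?b R powr r * exp (- R))"
        using elim by (simp add: pos_le_divide_eq)
      with elim show ?case by simp
    qed
  next
    \<comment> \<open>No limit is involved here: the ratio is at most \<open>1\<close> as soon as
      the ball of radius \<open>?b R\<close> has mass \<open>exp (- R)\<close>.\<close>
    fix a :: real assume "1 < a"
    show "\<forall>\<^sub>F R in at_top. ?D R / (?b R powr r * exp (- R)) < a"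
      using ev
    proof eventually_elim
      case (elim R)
      then have "?D R \<le> ?b R powr r * exp (- R)"
        using assms(5) by (intro enn2real_optimal_distortion_bounds) auto
      then have "?D R / (?b R powr r * exp (- R)) \<le> 1"
        using elim by (simp add: divide_le_eq)
      with \<open>1 < a\<close> show ?case by simp
    qed
  qed
qed

end
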